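(* There exists an interval exchange map $T$ of $d=4$ intervals, with admissible combinatorial data, with the Keane property and with total length $\lambda^*=1$, such that (R) $\lim_{r\to0^+}\frac{\log\tau_r(x)}{-\log r}=1$ for Lebesgue almost every $x\in[0,1)$, but $T$ does not satisfy the condition (Z) for every $\varepsilon>0$ there is $C_\varepsilon>0$ such that $\|Z(k,k+1)\|\le C_\varepsilon\|Z(k)\|^{\varepsilon}$ for all $k\ge1$.
   Context: Interval exchange maps. Let $\mathcal A$ be an alphabet with $d$ letters. Combinatorial data is a pair $\pi=(\pi_t,\pi_b)$ of bijections $\mathcal A\to\{1,\dots,d\}$; it is admissible if $\pi_t^{-1}(\{1,\dots,k\})\ne\pi_b^{-1}(\{1,\dots,k\})$ for $k=1,\dots,d-1$. Length data is a vector $(\lambda_\alpha)_{\alpha\in\mathcal A}$ of positive reals; $\lambda^*=\sum_\alpha\lambda_\alpha$, $I=[0,\lambda^* )$, $p_\alpha=\sum_{\pi_t(\beta)<\pi_t(\alpha)}\lambda_\beta$, $I_\alpha=[p_\alpha,p_\alpha+\lambda_\alpha)$. The map is $T(x)=x+\sum_{\pi_b(\beta)<\pi_b(\alpha)}\lambda_\beta-\sum_{\pi_t(\beta)<\pi_t(\alpha)}\lambda_\beta$ for $x\in I_\alpha$. Keane property: there are no $\alpha,\beta\in\mathcal A$ and $m\ge1$ with $T^m(p_\alpha)=p_\beta$ and $\pi_t(\beta)>1$. Return time. $\tau_r(x)=\min\{j\ge1:\ |T^jx-x|<r\}$ for $r>0$, $x\in I$. Rauzy–Veech algorithm. Let $\alpha_t,\alpha_b$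 be the letters with $\pi_t(\alpha_t)=\pi_b(\alpha_b)=d$. If $\lambda_{\alpha_t}>\lambda_{\alpha_b}$ (top type) the winner is $\alpha_t$ and the loser $\alpha_b$; the new data keep $\pi_t$, and in the order given by $\pi_b$ the letter $\alpha_b$ is moved to the position immediately after $\alpha_t$. If $\lambda_{\alpha_b}>\lambda_{\alpha_t}$ (bottom type) the winner is $\alpha_b$ and the loser $\alpha_t$; the new data keep $\pi_b$, and in the order given by $\pi_t$ the letter $\alpha_t$ is moved to the position immediately after $\alpha_b$. In both cases the winner's length is replaced by (winner's length minus loser's length) and all other lengths are kept. The new map $\mathcal V(T)$ is the first return map of $T$ to $[0,\sum_\alpha\hat\lambda_\alpha)$, where $\hat\lambda$ is the new length vector. For $T$ admissible with the Keane property this can be iterated forever; $T(n)=\mathcal V^n(T)$. Write $\gamma(m,n)$ for the sequence of steps (arrows) from $T(m)$ to $T(n)$. For a step with winner $\alpha$ and loser $\beta$ put $B=\mathbb I+E_{\beta\alpha}$ ($E_{\beta\alpha}$ has its only nonzero entry, a $1$, in row $\beta$, column $\alpha$); $Q(m,n)$ is the product of the matrices of the steps of $\gamma(m,n)$, later steps on the left. The norm $\|\cdot\|$ of a matrix is the sum of the absolute values of its entries. Zorich acceleration. $n_0=0$ and $n_{k+1}>n_k$ is the largest integer such that all steps in $\gamma(n_k,n_{k+1})$ have the same winner. $Z(k)=Q(0,n_k)$, $Z(k,\ell)=Q(n_k,n_\ell)$. *)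

theory Defs
  imports "HOL-Analysis.Analysis"
begin

section \<open>Interval exchange maps\<close>

text \<open>The alphabet is the whole type \<open>'a\<close>, so the number \<open>d\<close> of letters is \<open>CARD('a)\<close>;
  positions are counted from \<open>1\<close>.\<close>

record 'a iet =
  pi_t :: "'a \<Rightarrow> nat"
  pi_b :: "'a \<Rightarrow> nat"
  len :: "'a \<Rightarrow> real"

definition is_iet :: "'a::finite iet \<Rightarrow> bool" where
  "is_iet T \<longleftrightarrow>
     bij_betw (pi_t T) UNIV {1..CARD('a)} \<and>
     bij_betw (pi_b T) UNIV {1..CARD('a)} \<and>
     (\<forall>\<alpha>. 0 < len T \<alpha>)"

definition admissible :: "'a::finite iet \<Rightarrow> bool" where
  "admissible T \<longleftrightarrow> (\<forall>k\<in>{1..CARD('a) - 1}. pi_t T -` {1..k} \<noteq> pi_b T -` {1..k})"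

definition total_len :: "'a::finite iet \<Rightarrow> real" where
  "total_len T = (\<Sum>\<alpha>\<in>UNIV. len T \<alpha>)"

definition left_end :: "'a::finite iet \<Rightarrow> 'a \<Rightarrow> real" where
  "left_end T \<alpha> = (\<Sum>\<beta> | pi_t T \<beta> < pi_t T \<alpha>. len T \<beta>)"

definition iet_interval :: "'a::finite iet \<Rightarrow> 'a \<Rightarrow> real set" where
  "iet_interval T \<alpha> = {left_end T \<alpha> ..< left_end T \<alpha> + len T \<alpha>}"

definition translation :: "'a::finite iet \<Rightarrow> 'a \<Rightarrow> real" where
  "translation T \<alpha> =
     (\<Sum>\<beta> | pi_b T \<beta> < pi_b T \<alpha>. len T \<beta>) - (\<Sum>\<beta> | pi_t T \<beta> < pi_t T \<alpha>. len T \<beta>)"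

text \<open>For \<open>x\<close> in \<open>[0, total_len T)\<close> exactly one letter contributes to the sum, and the value lies
  again in \<open>[0, total_len T)\<close>; outside this interval the map is extended by the identity.\<close>

definition iet_map :: "'a::finite iet \<Rightarrow> real \<Rightarrow> real" where
  "iet_map T x = x + (\<Sum>\<alpha> | x \<in> iet_interval T \<alpha>. translation T \<alpha>)"

definition keane :: "'a::finite iet \<Rightarrow> bool" where
  "keane T \<longleftrightarrow>
     \<not> (\<exists>\<alpha> \<beta> m. 1 \<le> m \<and> (iet_map T ^^ m) (left_end T \<alpha>) = left_end T \<beta> \<and> 1 < pi_t T \<beta>)"

definition return_time :: "'a::finite iet \<Rightarrow> real \<Rightarrow> real \<Rightarrow> nat" where
  "return_time T r x = (LEAST j. 1 \<le> j \<and> \<bar>(iet_map T ^^ j) x - x\<bar> < r)"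


section \<open>The Rauzy--Veech algorithm\<close>

definition last_t :: "'a::finite iet \<Rightarrow> 'a" where
  "last_t T = (THE \<alpha>. pi_t T \<alpha> = CARD('a))"

definition last_b :: "'a::finite iet \<Rightarrow> 'a" where
  "last_b T = (THE \<alpha>. pi_b T \<alpha> = CARD('a))"

text \<open>A tie \<open>len T (last_t T) = len T (last_b T)\<close> is treated as bottom type below; it never
  occurs along the algorithm when \<open>T\<close> is admissible and has the Keane property.\<close>

definition top_type :: "'a::finite iet \<Rightarrow> bool" where
  "top_type T \<longleftrightarrow> len T (last_t T) > len T (last_b T)"

definition winner :: "'a::finite iet \<Rightarrow> 'a" where
  "winner T = (if top_type T then last_t T else last_b T)"

definition loser :: "'a::finite iet \<Rightarrow> 'a" where
  "loser T = (if top_type T then last_b T else last_t T)"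

text \<open>\<open>move_after p \<alpha> \<beta>\<close> moves \<open>\<alpha>\<close> to the position right after \<open>\<beta>\<close>, where \<open>\<beta>\<close> precedes \<open>\<alpha>\<close> in
  the order given by \<open>p\<close>; the letters in between shift by one.\<close>

definition move_after :: "('a \<Rightarrow> nat) \<Rightarrow> 'a \<Rightarrow> 'a \<Rightarrow> 'a \<Rightarrow> nat" where
  "move_after p \<alpha> \<beta> = (\<lambda>\<gamma>.
     if \<gamma> = \<alpha> then p \<beta> + 1
     else if p \<beta> < p \<gamma> \<and> p \<gamma> < p \<alpha> then p \<gamma> + 1
     else p \<gamma>)"

definition rv_step :: "'a::finite iet \<Rightarrow> 'a iet" where
  "rv_step T =
     \<lparr> pi_t = (if top_type T then pi_t T else move_after (pi_t T) (last_t T) (last_b T)),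
       pi_b = (if top_type T then move_after (pi_b T) (last_b T) (last_t T) else pi_b T),
       len = (len T)(winner T := len T (winner T) - len T (loser T)) \<rparr>"

definition rv_iter :: "'a::finite iet \<Rightarrow> nat \<Rightarrow> 'a iet" where
  "rv_iter T n = (rv_step ^^ n) T"

text \<open>Row index first: the extra entry is in row \<open>loser T\<close>, column \<open>winner T\<close>.\<close>

definition step_matrix :: "'a::finite iet \<Rightarrow> real^'a^'a" where
  "step_matrix T = mat 1 + (\<chi> i j. if i = loser T \<and> j = winner T then 1 else 0)"

text \<open>Only the values with \<open>m \<le> n\<close> are meaningful.\<close>

primrec rv_matrix :: "'a::finite iet \<Rightarrow> nat \<Rightarrow> nat \<Rightarrow> real^'a^'a" where
  "rv_matrix T m 0 = mat 1"
| "rv_matrix T m (Suc n) =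
     (if m \<le> n then step_matrix (rv_iter T n) ** rv_matrix T m n else mat 1)"

definition entry_norm :: "real^'a^'b \<Rightarrow> real" where
  "entry_norm A = (\<Sum>i\<in>UNIV. \<Sum>j\<in>UNIV. \<bar>A $ i $ j\<bar>)"


section \<open>The Zorich acceleration\<close>

text \<open>The step from \<open>T(j)\<close> to \<open>T(j+1)\<close> has winner \<open>winner (rv_iter T j)\<close>.\<close>

primrec zorich_time :: "'a::finite iet \<Rightarrow> nat \<Rightarrow> nat" where
  "zorich_time T 0 = 0"
| "zorich_time T (Suc k) =
     (GREATEST n. zorich_time T k < n \<and>
        (\<exists>\<alpha>. \<forall>j\<in>{zorich_time T k..<n}. winner (rv_iter T j) = \<alpha>))"

definition zorich_matrix :: "'a::finite iet \<Rightarrow> nat \<Rightarrow> nat \<Rightarrow> real^'a^'a" where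
  "zorich_matrix T k l = rv_matrix T (zorich_time T k) (zorich_time T l)"

text \<open>\<open>Z(k)\<close> is \<open>zorich_matrix T 0 k\<close>, since \<open>zorich_time T 0 = 0\<close>.\<close>

definition condition_Z :: "'a::finite iet \<Rightarrow> bool" where
  "condition_Z T \<longleftrightarrow>
     (\<forall>\<epsilon>>0. \<exists>C>0. \<forall>k\<ge>1.
        entry_norm (zorich_matrix T k (k + 1)) \<le> C * entry_norm (zorich_matrix T 0 k) powr \<epsilon>)"

definition condition_R :: "'a::finite iet \<Rightarrow> bool" where
  "condition_R T \<longleftrightarrow>
     (AE x in lebesgue. x \<in> {0..<total_len T} \<longrightarrow>
        ((\<lambda>r. ln (real (return_time T r x)) / (- ln r)) \<longlongrightarrow> 1) (at_right 0))"

end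

theory Submission
  imports Defs
begin

text \<open>
  The map is given by an infinite path in the Rauzy diagram of \<open>(A B C D / D C B A)\<close> made of blocks.
  In a block \<open>D\<close> first beats \<open>A\<close>; then the letters \<open>B, C, D\<close> play among themselves along a hyperbolic
  loop, which multiplies their heights by bounded factors \<open>2l\<close> times while \<open>A\<close> keeps its much smaller
  height; finally \<open>A\<close> beats \<open>D, C, B\<close> cyclically \<open>2^l\<close> times in a row. That streak is a single Zorich
  step of norm at least \<open>2^l\<close>, a fixed power of the norm of the preceding product, so (Z) fails.

  At all intermediate scales the towers over \<open>B, C, D\<close> have comparable heights, and the only low
  tower, the one over \<open>A\<close>, has area at most a negative power of the scale. A point that returns close
  to itself before its tower height lies in the tower over \<open>A\<close> or close to the boundary of its level,
  and by Borel--Cantelli almost every point avoids these sets at all small scales. The upper bound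
  for the return time is Kac's argument, and the Keane property holds because each left end
  \<open>left_end T \<beta>\<close> with \<open>\<beta> \<noteq> A\<close> sits arbitrarily high in the tower over \<open>\<beta>\<close>.
\<close>

section \<open>Interval exchange maps\<close>

text \<open>A Zorich step of norm N adds about N times the winner's height to the losers. If the
  winner is about as high as they are, the heights jump by a factor N, a power of the scale, and the
  towers no longer control the return times in between. So the winner must be so low that N times
  its height is at most comparable with the losers, and its tower, too low to be useful, must have
  polynomially small area. In a block with parameter l the loops raise B, C and D by a factor of at
  least 2^l * 2^l: one factor 2^l absorbs the streak, the other makes the area of the tower over A
  at most a constant times 2^(-l). The parameter l doubles from block to block, so all earlier
  growth is only exponential in l, and both 2^l and 2^(-l) are fixed powers of the scale. The
  lengths are found backwards, as a common point of nested compact sets. No ergodicity enters: both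
  bounds for the return time come from summable measures of exceptional sets.\<close>

definition left_sum :: "('a::finite \<Rightarrow> nat) \<Rightarrow> ('a \<Rightarrow> real) \<Rightarrow> 'a \<Rightarrow> real" where
  "left_sum p l \<gamma> = (\<Sum>\<beta> | p \<beta> < p \<gamma>. l \<beta>)"

lemma left_end_eq_left_sum: "left_end T = left_sum (pi_t T) (len T)"
  by (auto simp: left_end_def left_sum_def)

lemma translation_eq_left_sum:
  "translation T \<alpha> = left_sum (pi_b T) (len T) \<alpha> - left_sum (pi_t T) (len T) \<alpha>"
  by (simp add: translation_def left_sum_def)

lemma left_sum_nonneg: "(\<And>\<beta>. 0 \<le> l \<beta>) \<Longrightarrow> 0 \<le> left_sum p l \<gamma>"
  by (simp add: left_sum_def sum_nonneg)

lemma left_sum_add_le: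
  fixes p :: "'a::finite \<Rightarrow> nat"
  assumes "p \<beta> < p \<gamma>" and "\<And>\<beta>. 0 \<le> l \<beta>"
  shows "left_sum p l \<beta> + l \<beta> \<le> left_sum p l \<gamma>"
proof -
  have "left_sum p l \<beta> + l \<beta> = sum l (insert \<beta> {\<delta>. p \<delta> < p \<beta>})"
    by (simp add: left_sum_def add.commute)
  also have "\<dots> \<le> sum l {\<delta>. p \<delta> < p \<gamma>}"
    using assms by (intro sum_mono2) auto
  finally show ?thesis by (simp add: left_sum_def)
qed

lemma left_sum_add_le_total:
  fixes p :: "'a::finite \<Rightarrow> nat"
  assumes "\<And>\<beta>. 0 \<le> l \<beta>"
  shows "left_sum p l \<gamma> + l \<gamma> \<le> sum l UNIV"
proof -
  have "left_sum p l \<gamma> + l \<gamma> = sum l (insert \<gamma> {\<delta>. p \<delta> < p \<gamma>})"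
    by (simp add: left_sum_def add.commute)
  also have "\<dots> \<le> sum l UNIV"
    using assms by (intro sum_mono2) auto
  finally show ?thesis .
qed

lemma left_sum_add_eq_total:
  fixes p :: "'a::finite \<Rightarrow> nat"
  assumes "inj p" and "\<And>\<beta>. p \<beta> \<le> p \<gamma>"
  shows "left_sum p l \<gamma> + l \<gamma> = sum l UNIV"
proof -
  have "{\<delta>. p \<delta> < p \<gamma>} = UNIV - {\<gamma>}"
    using assms by (auto simp: inj_def order_less_le)
  then show ?thesis by (simp add: left_sum_def sum_diff1)
qed

lemma left_sum_unique:
  fixes p :: "'a::finite \<Rightarrow> nat"
  assumes "inj p" and "\<And>\<beta>. 0 \<le> l \<beta>"
    and "left_sum p l \<beta> \<le> y" "y < left_sum p l \<beta> + l \<beta>"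
    and "left_sum p l \<gamma> \<le> y" "y < left_sum p l \<gamma> + l \<gamma>"
  shows "\<beta> = \<gamma>"
proof (rule ccontr)
  assume "\<beta> \<noteq> \<gamma>"
  then have "p \<beta> < p \<gamma> \<or> p \<gamma> < p \<beta>" using assms(1) by (metis injD linorder_neqE_nat)
  then show False
    using left_sum_add_le[of p \<beta> \<gamma> l] left_sum_add_le[of p \<gamma> \<beta> l] assms by force
qed

text \<open>Among the letters whose interval starts at or before \<open>y\<close>, the one in the
  last position works: if \<open>y\<close> were beyond its right end, the next letter would qualify
  too, or \<open>y\<close> would exceed the total length.\<close>

lemma left_sum_exists:
  fixes p :: "'a::finite \<Rightarrow> nat"
  assumes p: "bij_betw p UNIV {1..CARD('a)}"
    and y: "0 \<le> y" "y < sum l UNIV"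
  shows "\<exists>\<gamma>. left_sum p l \<gamma> \<le> y \<and> y < left_sum p l \<gamma> + l \<gamma>"
proof -
  have inj: "inj p" and ran: "range p = {1..CARD('a)}" using p by (auto simp: bij_betw_def)
  have "1 \<in> range p" unfolding ran by (auto simp: Suc_le_eq)
  then obtain \<gamma>1 where \<gamma>1: "p \<gamma>1 = 1" by auto
  have "\<And>\<beta>. 1 \<le> p \<beta>" using ran by (metis atLeastAtMost_iff rangeI)
  then have "{\<beta>. p \<beta> < p \<gamma>1} = {}" using \<gamma>1 by (auto simp: not_less Suc_le_eq)
  then have \<gamma>1': "left_sum p l \<gamma>1 \<le> y" by (simp only: left_sum_def sum.empty y)
  let ?S = "{\<gamma>. left_sum p l \<gamma> \<le> y}"
  have "finite (p ` ?S)" "p ` ?S \<noteq> {}" using \<gamma>1' by auto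
  then have "Max (p ` ?S) \<in> p ` ?S" by (rule Max_in)
  then obtain \<gamma> where \<gamma>: "left_sum p l \<gamma> \<le> y" "p \<gamma> = Max (p ` ?S)" by auto
  have mx: "left_sum p l \<delta> \<le> y \<Longrightarrow> p \<delta> \<le> p \<gamma>" for \<delta> using \<gamma> by auto
  have "y < left_sum p l \<gamma> + l \<gamma>"
  proof (cases "p \<gamma> = CARD('a)")
    case True
    then have "p \<beta> \<le> p \<gamma>" for \<beta> using ran by (metis atLeastAtMost_iff rangeI)
    then show ?thesis using left_sum_add_eq_total[OF inj, of \<gamma> l] y by simp
  next
    case False
    have "p \<gamma> \<in> range p" by simp
    then have "Suc (p \<gamma>) \<in> range p" using False unfolding ran by auto
    then obtain \<delta> where \<delta>: "p \<delta> = Suc (p \<gamma>)" by (metis imageE)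
    have "{\<beta>. p \<beta> < p \<delta>} = insert \<gamma> {\<beta>. p \<beta> < p \<gamma>}"
      using inj \<delta> by (auto simp: less_Suc_eq inj_eq)
    then have "left_sum p l \<delta> = left_sum p l \<gamma> + l \<gamma>"
      by (simp add: left_sum_def add.commute)
    moreover have "\<not> left_sum p l \<delta> \<le> y" using mx[of \<delta>] \<delta> by auto
    ultimately show ?thesis by simp
  qed
  then show ?thesis using \<gamma> by auto
qed

section \<open>The map as a bijection between the top and the bottom partition\<close>

lemma is_ietD:
  fixes T :: "'a::finite iet"
  assumes "is_iet T"
  shows "inj (pi_t T)" "inj (pi_b T)" "0 < len T \<alpha>" "0 \<le> len T \<alpha>"
    "bij_betw (pi_t T) UNIV {1..CARD('a)}" "bij_betw (pi_b T) UNIV {1..CARD('a)}"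
  using assms by (auto simp: is_iet_def bij_betw_def less_imp_le)

lemma iet_top_unique:
  assumes "is_iet T" "left_sum (pi_t T) (len T) \<beta> \<le> y" "y < left_sum (pi_t T) (len T) \<beta> + len T \<beta>"
    "left_sum (pi_t T) (len T) \<gamma> \<le> y" "y < left_sum (pi_t T) (len T) \<gamma> + len T \<gamma>"
  shows "\<beta> = \<gamma>"
  by (rule left_sum_unique[of "pi_t T" "len T"]) (use assms is_ietD in auto)

lemma iet_bottom_unique:
  assumes "is_iet T" "left_sum (pi_b T) (len T) \<beta> \<le> y" "y < left_sum (pi_b T) (len T) \<beta> + len T \<beta>"
    "left_sum (pi_b T) (len T) \<gamma> \<le> y" "y < left_sum (pi_b T) (len T) \<gamma> + len T \<gamma>"
  shows "\<beta> = \<gamma>"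
  by (rule left_sum_unique[of "pi_b T" "len T"]) (use assms is_ietD in auto)

lemma iet_map_eq:
  fixes T :: "'a::finite iet"
  assumes "is_iet T" "left_end T \<alpha> \<le> x" "x < left_end T \<alpha> + len T \<alpha>"
  shows "iet_map T x = x + translation T \<alpha>"
proof -
  have "{\<beta>. x \<in> iet_interval T \<beta>} = {\<alpha>}"
  proof (intro equalityI subsetI)
    fix \<beta> assume "\<beta> \<in> {\<beta>. x \<in> iet_interval T \<beta>}"
    then have "\<beta> = \<alpha>"
      using assms by (intro iet_top_unique[OF assms(1), where y=x]) (simp_all add: iet_interval_def left_end_eq_left_sum)
    then show "\<beta> \<in> {\<alpha>}" by simp
  qed (use assms in \<open>simp add: iet_interval_def\<close>)
  then show ?thesis by (simp add: iet_map_def)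
qed

lemma iet_interval_exists:
  assumes "is_iet T" "0 \<le> x" "x < total_len T"
  obtains \<alpha> where "left_end T \<alpha> \<le> x" "x < left_end T \<alpha> + len T \<alpha>"
  using left_sum_exists[OF is_ietD(5)[OF assms(1)], of x "len T"] assms
  by (auto simp: left_end_eq_left_sum total_len_def)

lemma iet_map_mem_bottom:
  assumes "is_iet T" "left_end T \<alpha> \<le> x" "x < left_end T \<alpha> + len T \<alpha>"
  shows "left_sum (pi_b T) (len T) \<alpha> \<le> iet_map T x"
    "iet_map T x < left_sum (pi_b T) (len T) \<alpha> + len T \<alpha>"
  using iet_map_eq[OF assms] assms
  by (auto simp: translation_eq_left_sum left_end_eq_left_sum)

lemma iet_map_range:
  assumes "is_iet T" "0 \<le> x" "x < total_len T"
  shows "0 \<le> iet_map T x" "iet_map T x < total_len T"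
proof -
  obtain \<alpha> where "left_end T \<alpha> \<le> x" "x < left_end T \<alpha> + len T \<alpha>"
    using iet_interval_exists[OF assms] .
  note m = iet_map_mem_bottom[OF assms(1) this]
  show "0 \<le> iet_map T x"
    using m left_sum_nonneg[of "len T" "pi_b T" \<alpha>] is_ietD[OF assms(1)] by auto
  show "iet_map T x < total_len T"
    using m left_sum_add_le_total[of "len T" "pi_b T" \<alpha>] is_ietD[OF assms(1)]
    by (auto simp: total_len_def)
qed

lemma iet_map_funpow_range:
  assumes "is_iet T" "0 \<le> x" "x < total_len T"
  shows "0 \<le> (iet_map T ^^ n) x \<and> (iet_map T ^^ n) x < total_len T"
  by (induction n) (use assms iet_map_range in auto)

lemma iet_map_inj:
  assumes T: "is_iet T" and x: "0 \<le> x" "x < total_len T" and y: "0 \<le> y" "y < total_len T"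
    and eq: "iet_map T x = iet_map T y"
  shows "x = y"
proof -
  obtain \<alpha> where \<alpha>: "left_end T \<alpha> \<le> x" "x < left_end T \<alpha> + len T \<alpha>"
    using iet_interval_exists[OF T x] .
  obtain \<beta> where \<beta>: "left_end T \<beta> \<le> y" "y < left_end T \<beta> + len T \<beta>"
    using iet_interval_exists[OF T y] .
  have "\<alpha> = \<beta>"
    using iet_map_mem_bottom[OF T \<alpha>] iet_map_mem_bottom[OF T \<beta>] unfolding eq
    by (rule iet_bottom_unique[OF T])
  then show ?thesis using iet_map_eq[OF T \<alpha>] iet_map_eq[OF T \<beta>] eq by (metis add_right_cancel)
qed

lemma iet_map_funpow_inj:
  assumes T: "is_iet T" and x: "0 \<le> x" "x < total_len T" and y: "0 \<le> y" "y < total_len T"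
    and eq: "(iet_map T ^^ n) x = (iet_map T ^^ n) y"
  shows "x = y"
  using eq
proof (induction n)
  case (Suc n)
  then show ?case
    using iet_map_inj[OF T] iet_map_funpow_range[OF T x, of n] iet_map_funpow_range[OF T y, of n] by simp
qed simp

section \<open>Measurability and invariance of Lebesgue measure\<close>

lemma iet_map_measurable [measurable]: "iet_map T \<in> borel_measurable borel"
proof -
  have "iet_map T = (\<lambda>x. x + (\<Sum>\<alpha>\<in>UNIV. translation T \<alpha> * indicator (iet_interval T \<alpha>) x))"
    by (simp add: iet_map_def fun_eq_iff indicator_def sum.inter_filter flip: sum.inter_filter)
  moreover have "iet_interval T \<alpha> \<in> sets borel" for \<alpha> by (simp add: iet_interval_def)
  then have "(\<lambda>x. x + (\<Sum>\<alpha>\<in>UNIV. translation T \<alpha> * indicator (iet_interval T \<alpha>) x)) \<in> borel_measurable borel"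
    by (intro borel_measurable_add borel_measurable_sum borel_measurable_times borel_measurable_indicator) auto
  ultimately show ?thesis by metis
qed

lemma iet_map_funpow_measurable [measurable]: "(iet_map T ^^ n) \<in> borel_measurable borel"
  by (induction n) (auto intro: measurable_comp)

text \<open>\<open>E\<close> is cut along the bottom partition. The preimage of each piece is a
  translate of it, and these translates are disjoint because they lie in different intervals of the
  top partition.\<close>

lemma emeasure_iet_map_vimage:
  assumes T: "is_iet T" and E: "E \<in> sets borel" "E \<subseteq> {0..<total_len T}"
  shows "emeasure lborel (iet_map T -` E \<inter> {0..<total_len T}) = emeasure lborel E"
proof -
  let ?t = "translation T" and ?b = "\<lambda>\<alpha>. {left_sum (pi_b T) (len T) \<alpha> ..< left_sum (pi_b T) (len T) \<alpha> + len T \<alpha>}"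
  have 1: "iet_map T -` E \<inter> {0..<total_len T} = (\<Union>\<alpha>. (\<lambda>x. ?t \<alpha> + x) -` (E \<inter> ?b \<alpha>))"
  proof (intro set_eqI iffI)
    fix x assume x: "x \<in> iet_map T -` E \<inter> {0..<total_len T}"
    then obtain \<alpha> where \<alpha>: "left_end T \<alpha> \<le> x" "x < left_end T \<alpha> + len T \<alpha>"
      using iet_interval_exists[OF T, of x] by auto
    have "?t \<alpha> + x \<in> E \<inter> ?b \<alpha>"
      using iet_map_mem_bottom[OF T \<alpha>] x unfolding iet_map_eq[OF T \<alpha>] by (auto simp: iet_map_eq[OF T \<alpha>] add.commute)
    then show "x \<in> (\<Union>\<alpha>. (\<lambda>x. ?t \<alpha> + x) -` (E \<inter> ?b \<alpha>))" by auto
  next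
    fix x assume "x \<in> (\<Union>\<alpha>. (\<lambda>x. ?t \<alpha> + x) -` (E \<inter> ?b \<alpha>))"
    then obtain \<alpha> where \<alpha>: "?t \<alpha> + x \<in> E" "?t \<alpha> + x \<in> ?b \<alpha>" by auto
    then have \<alpha>': "left_end T \<alpha> \<le> x" "x < left_end T \<alpha> + len T \<alpha>"
      by (auto simp: translation_eq_left_sum left_end_eq_left_sum)
    show "x \<in> iet_map T -` E \<inter> {0..<total_len T}"
      using \<alpha> \<alpha>' left_sum_nonneg[of "len T" "pi_t T" \<alpha>] is_ietD(4)[OF T]
        left_sum_add_le_total[of "len T" "pi_t T" \<alpha>]
      by (auto simp: iet_map_eq[OF T \<alpha>'] add.commute left_end_eq_left_sum total_len_def)
  qed
  have disj: "disjoint_family_on (\<lambda>\<alpha>. E \<inter> ?b \<alpha>) UNIV"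
  proof -
    have "m = n" if "y \<in> ?b m" "y \<in> ?b n" for m n y
      using that iet_bottom_unique[OF T, where \<beta>=m and \<gamma>=n and y=y] by simp
    then show ?thesis unfolding disjoint_family_on_def by blast
  qed
  have disj': "disjoint_family_on (\<lambda>\<alpha>. (\<lambda>x. ?t \<alpha> + x) -` (E \<inter> ?b \<alpha>)) UNIV"
  proof -
    have "m = n" if "?t m + x \<in> ?b m" "?t n + x \<in> ?b n" for m n x
      using that iet_top_unique[OF T, where \<beta>=m and \<gamma>=n and y=x]
      by (simp add: translation_eq_left_sum)
    then show ?thesis unfolding disjoint_family_on_def by blast
  qed
  have shift: "emeasure lborel ((\<lambda>x. c + x) -` A) = emeasure lborel A" if "A \<in> sets borel" for c and A :: "real set"
    using that by (subst (2) lborel_distr_plus[symmetric, of c]) (simp add: emeasure_distr)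
  have 2: "(\<Union>\<alpha>. E \<inter> ?b \<alpha>) = E"
  proof (intro equalityI subsetI)
    fix y assume y: "y \<in> E"
    with E obtain \<alpha> where "y \<in> ?b \<alpha>"
      using left_sum_exists[OF is_ietD(6)[OF T], of y "len T"] by (auto simp: total_len_def subset_iff)
    with y show "y \<in> (\<Union>\<alpha>. E \<inter> ?b \<alpha>)" by auto
  qed auto
  have m: "(\<lambda>x. c + x) -` A \<in> sets borel" if "A \<in> sets borel" for c and A :: "real set"
    using measurable_sets_borel[of "\<lambda>x. c + x" borel A] that by simp
  have "emeasure lborel (\<Union>\<alpha>. (\<lambda>x. ?t \<alpha> + x) -` (E \<inter> ?b \<alpha>)) = (\<Sum>\<alpha>\<in>UNIV. emeasure lborel ((\<lambda>x. ?t \<alpha> + x) -` (E \<inter> ?b \<alpha>)))"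
    using E disj' by (intro sum_emeasure[symmetric]) (auto intro!: m)
  also have "\<dots> = (\<Sum>\<alpha>\<in>UNIV. emeasure lborel (E \<inter> ?b \<alpha>))"
    using E by (intro sum.cong refl shift) auto
  also have "\<dots> = emeasure lborel (\<Union>\<alpha>. E \<inter> ?b \<alpha>)"
    using E disj by (intro sum_emeasure) auto
  finally show ?thesis unfolding 1 2 .
qed

lemma emeasure_iet_map_funpow_vimage:
  assumes T: "is_iet T" and E: "E \<in> sets borel" "E \<subseteq> {0..<total_len T}"
  shows "emeasure lborel ((iet_map T ^^ n) -` E \<inter> {0..<total_len T}) = emeasure lborel E"
proof (induction n)
  case 0
  then show ?case using E by (simp add: Int_absorb2)
next
  case (Suc n)
  have "(iet_map T ^^ Suc n) -` E \<inter> {0..<total_len T}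
     = iet_map T -` ((iet_map T ^^ n) -` E \<inter> {0..<total_len T}) \<inter> {0..<total_len T}"
    using iet_map_range[OF T] by (auto simp: funpow_swap1 simp del: funpow.simps(2)) (auto simp: funpow_Suc_right simp del: funpow.simps(2))
  moreover have "(iet_map T ^^ n) -` E \<in> sets borel"
    by (rule measurable_sets_borel[OF iet_map_funpow_measurable E(1)])
  then have "emeasure lborel (iet_map T -` ((iet_map T ^^ n) -` E \<inter> {0..<total_len T}) \<inter> {0..<total_len T})
      = emeasure lborel ((iet_map T ^^ n) -` E \<inter> {0..<total_len T})"
    by (intro emeasure_iet_map_vimage[OF T]) auto
  ultimately show ?case using Suc by (simp only:)
qed

text \<open>The preimages of \<open>E\<close> under the first \<open>N\<close> iterates are pairwise disjoint and have the same measure.\<close>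

lemma emeasure_no_return:
  assumes T: "is_iet T" and E: "E \<in> sets borel" "E \<subseteq> {0..<total_len T}"
    and nr: "\<And>x j. x \<in> E \<Longrightarrow> 1 \<le> j \<Longrightarrow> j \<le> N \<Longrightarrow> (iet_map T ^^ j) x \<notin> E"
  shows "of_nat (Suc N) * emeasure lborel E \<le> ennreal (total_len T)"
proof -
  let ?F = "\<lambda>i. (iet_map T ^^ i) -` E \<inter> {0..<total_len T}"
  have no: False if "(iet_map T ^^ i) y \<in> E" "(iet_map T ^^ j) y \<in> E" "i < j" "j \<le> N" for i j y
  proof -
    have "(iet_map T ^^ (j - i)) ((iet_map T ^^ i) y) = (iet_map T ^^ j) y"
      using \<open>i < j\<close> fun_cong[OF funpow_add[of "j - i" i "iet_map T"], of y] by simp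
    moreover have "1 \<le> j - i" "j - i \<le> N" using that by auto
    ultimately show False using nr[OF that(1)] that(2) by metis
  qed
  have disj: "disjoint_family_on ?F {..N}"
  proof -
    have "i = j" if "y \<in> ?F i" "y \<in> ?F j" "i \<le> N" "j \<le> N" for i j y
      using no[of i y j] no[of j y i] that by (cases i j rule: linorder_cases) auto
    then show ?thesis unfolding disjoint_family_on_def by blast
  qed
  have meas: "?F i \<in> sets borel" for i
    by (intro sets.Int measurable_sets_borel[OF iet_map_funpow_measurable E(1)]) simp
  have "of_nat (Suc N) * emeasure lborel E = (\<Sum>i\<in>{..N}. emeasure lborel (?F i))"
    using emeasure_iet_map_funpow_vimage[OF T E] by simp
  also have "\<dots> = emeasure lborel (\<Union>i\<in>{..N}. ?F i)"
    using meas disj by (intro sum_emeasure) auto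
  also have "\<dots> \<le> emeasure lborel {0..<total_len T}"
    using meas by (intro emeasure_mono) auto
  also have "\<dots> = ennreal (total_len T)"
    using is_ietD(4)[OF T] by (simp add: total_len_def sum_nonneg)
  finally show ?thesis .
qed

section \<open>Cutting and stacking\<close>

text \<open>Level \<open>j\<close> of the tower over the letter \<open>\<gamma>\<close> is the interval of length \<open>l \<gamma>\<close> starting at
  \<open>u \<gamma> j\<close>; the value \<open>u \<gamma> (h \<gamma>)\<close> is the left end of the image of the top level.\<close>

definition in_level :: "('a \<Rightarrow> real) \<Rightarrow> ('a \<Rightarrow> nat) \<Rightarrow> ('a \<Rightarrow> nat \<Rightarrow> real) \<Rightarrow> 'a \<Rightarrow> nat \<Rightarrow> real \<Rightarrow> bool" where
  "in_level l h u \<gamma> j x \<longleftrightarrow> j < h \<gamma> \<and> u \<gamma> j \<le> x \<and> x < u \<gamma> j + l \<gamma>"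

text \<open>The first clause includes the top level of each tower, so
  \<open>u \<gamma> (h \<gamma>)\<close> records where the tower ends; that place need not be the
  start of a level. Restacking can then be checked without mentioning a return map.\<close>

definition stack :: "(real \<Rightarrow> real) \<Rightarrow> real set \<Rightarrow> ('a \<Rightarrow> real) \<Rightarrow> ('a \<Rightarrow> nat) \<Rightarrow> ('a \<Rightarrow> nat \<Rightarrow> real) \<Rightarrow> bool" where
  "stack f X l h u \<longleftrightarrow>
     (\<forall>\<gamma> j x. in_level l h u \<gamma> j x \<longrightarrow> f x = x + (u \<gamma> (Suc j) - u \<gamma> j)) \<and>
     (\<forall>x. x \<in> X \<longleftrightarrow> (\<exists>\<gamma> j. in_level l h u \<gamma> j x)) \<and>
     (\<forall>\<gamma> j \<gamma>' j' x. in_level l h u \<gamma> j x \<longrightarrow> in_level l h u \<gamma>' j' x \<longrightarrow> \<gamma> = \<gamma>' \<and> j = j')"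

lemma stackD:
  assumes "stack f X l h u"
  shows stack_map: "in_level l h u \<gamma> j x \<Longrightarrow> f x = x + (u \<gamma> (Suc j) - u \<gamma> j)"
    and stack_cover: "x \<in> X \<Longrightarrow> \<exists>\<gamma> j. in_level l h u \<gamma> j x"
    and stack_subset: "in_level l h u \<gamma> j x \<Longrightarrow> x \<in> X"
    and stack_unique: "in_level l h u \<gamma> j x \<Longrightarrow> in_level l h u \<gamma>' j' x \<Longrightarrow> \<gamma> = \<gamma>' \<and> j = j'"
  using assms unfolding stack_def by blast+

text \<open>\<open>\<rho>\<close> sends the levels of the new towers to
  the levels of the old ones that contain them.\<close>

lemma stack_refine:
  assumes st: "stack f X l h u"
    and into: "\<And>\<gamma> j x. in_level l' h' u' \<gamma> j x \<Longrightarrow>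
      in_level l h u (fst (\<rho> \<gamma> j)) (snd (\<rho> \<gamma> j)) x \<and>
      u' \<gamma> (Suc j) - u' \<gamma> j = u (fst (\<rho> \<gamma> j)) (Suc (snd (\<rho> \<gamma> j))) - u (fst (\<rho> \<gamma> j)) (snd (\<rho> \<gamma> j))"
    and onto: "\<And>\<gamma> j x. in_level l h u \<gamma> j x \<Longrightarrow> \<exists>\<gamma>' j'. in_level l' h' u' \<gamma>' j' x"
    and inj: "\<And>\<gamma> j \<gamma>' j' x. in_level l' h' u' \<gamma> j x \<Longrightarrow> in_level l' h' u' \<gamma>' j' x \<Longrightarrow> \<rho> \<gamma> j = \<rho> \<gamma>' j' \<Longrightarrow> \<gamma> = \<gamma>' \<and> j = j'"
  shows "stack f X l' h' u'"
  unfolding stack_def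
proof (intro conjI allI impI)
  fix \<gamma> j x assume "in_level l' h' u' \<gamma> j x"
  then show "f x = x + (u' \<gamma> (Suc j) - u' \<gamma> j)"
    using into stack_map[OF st] by metis
next
  fix x show "x \<in> X \<longleftrightarrow> (\<exists>\<gamma> j. in_level l' h' u' \<gamma> j x)"
    using into onto stack_subset[OF st] stack_cover[OF st] by metis
next
  fix \<gamma> j \<gamma>' j' x assume *: "in_level l' h' u' \<gamma> j x" "in_level l' h' u' \<gamma>' j' x"
  have "fst (\<rho> \<gamma> j) = fst (\<rho> \<gamma>' j') \<and> snd (\<rho> \<gamma> j) = snd (\<rho> \<gamma>' j')"
    using into[OF *(1)] into[OF *(2)] stack_unique[OF st] by metis
  then have "\<rho> \<gamma> j = \<rho> \<gamma>' j'" by (simp add: prod_eq_iff)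
  from inj[OF * this] show "\<gamma> = \<gamma>'" "j = j'" by auto
qed

text \<open>By \<open>joint\<close>, the top level over the loser \<open>x\<close> is mapped onto
  the right-hand piece, of width \<open>l x\<close>, of the base under the winner \<open>w\<close>.
  The column above that piece is cut off from \<open>w\<close> and put on top of
  \<open>x\<close>.\<close>

lemma stack_top:
  assumes st: "stack f X l h u" and neq: "x \<noteq> w" and less: "l x < l w" and pos: "0 < l x"
    and joint: "u x (h x) = u w 0 + (l w - l x)"
  shows "stack f X (l(w := l w - l x)) (h(x := h x + h w))
    (u(x := (\<lambda>j. if j < h x then u x j else u w (j - h x) + (l w - l x))))"
    (is "stack f X ?l ?h ?u")
proof (rule stack_refine[OF st, where \<rho> = "\<lambda>\<gamma> j. if \<gamma> = x \<and> h x \<le> j then (w, j - h x) else (\<gamma>, j)"], goal_cases)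
  case (1 \<gamma> j y)
  consider "\<gamma> = x" "h x \<le> j" | "\<gamma> = x" "j < h x" | "\<gamma> \<noteq> x" by linarith
  then show ?case
  proof cases
    case 1
    then show ?thesis using \<open>in_level ?l ?h ?u \<gamma> j y\<close> neq pos less
      by (auto simp: in_level_def Suc_diff_le)
  next
    case 2
    then show ?thesis using \<open>in_level ?l ?h ?u \<gamma> j y\<close> neq joint
      by (cases "Suc j < h x") (auto simp: in_level_def not_less less_Suc_eq_le dest: le_antisym)
  next
    case 3
    then show ?thesis using \<open>in_level ?l ?h ?u \<gamma> j y\<close> neq pos
      by (auto simp: in_level_def split: if_splits)
  qed
next
  case (2 \<gamma> j y)
  show ?case
  proof (cases "\<gamma> = w \<and> u w j + (l w - l x) \<le> y")
    case True
    then have "in_level ?l ?h ?u x (h x + j) y" using 2 neq by (auto simp: in_level_def)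
    then show ?thesis by blast
  next
    case False
    then have "in_level ?l ?h ?u \<gamma> j y" using 2 neq by (auto simp: in_level_def)
    then show ?thesis by blast
  qed
next
  case (3 \<gamma> j \<gamma>' j' y)
  then show ?case using neq by (auto simp: in_level_def split: if_splits)
qed

text \<open>Here it is the right-hand column of \<open>w\<close>, of width \<open>l x\<close>, whose
  top is mapped onto the base under \<open>x\<close>. It is put underneath, so the old levels over
  \<open>x\<close> move up by \<open>h w\<close>.\<close>

lemma stack_bottom:
  assumes st: "stack f X l h u" and neq: "x \<noteq> w" and less: "l x < l w" and pos: "0 < l x"
    and joint: "u w (h w) + (l w - l x) = u x 0"
  shows "stack f X (l(w := l w - l x)) (h(x := h x + h w))
    (u(x := (\<lambda>j. if j < h w then u w j + (l w - l x) else u x (j - h w))))"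
    (is "stack f X ?l ?h ?u")
proof (rule stack_refine[OF st, where \<rho> = "\<lambda>\<gamma> j. if \<gamma> = x then if j < h w then (w, j) else (x, j - h w) else (\<gamma>, j)"], goal_cases)
  case (1 \<gamma> j y)
  consider "\<gamma> = x" "h w \<le> j" | "\<gamma> = x" "j < h w" | "\<gamma> \<noteq> x" by linarith
  then show ?case
  proof cases
    case 1
    then show ?thesis using \<open>in_level ?l ?h ?u \<gamma> j y\<close> neq pos less
      by (auto simp: in_level_def Suc_diff_le)
  next
    case 2
    then show ?thesis using \<open>in_level ?l ?h ?u \<gamma> j y\<close> neq joint less
      by (cases "Suc j < h w") (auto simp: in_level_def not_less less_Suc_eq_le dest: le_antisym)
  next
    case 3
    then show ?thesis using \<open>in_level ?l ?h ?u \<gamma> j y\<close> neq pos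
      by (auto simp: in_level_def split: if_splits)
  qed
next
  case (2 \<gamma> j y)
  consider "\<gamma> = w" "u w j + (l w - l x) \<le> y" | "\<gamma> = x" | "\<gamma> \<noteq> x" "\<not> (\<gamma> = w \<and> u w j + (l w - l x) \<le> y)" by blast
  then show ?case
  proof cases
    case 1
    then have "in_level ?l ?h ?u x j y" using 2 neq by (auto simp: in_level_def)
    then show ?thesis by blast
  next
    case 2
    then have "in_level ?l ?h ?u x (h w + j) y" using \<open>in_level l h u \<gamma> j y\<close> neq by (auto simp: in_level_def)
    then show ?thesis by blast
  next
    case 3
    then have "in_level ?l ?h ?u \<gamma> j y" using 2 neq by (auto simp: in_level_def)
    then show ?thesis by blast
  qed
next
  case (3 \<gamma> j \<gamma>' j' y)
  then show ?case using neq by (auto simp: in_level_def split: if_splits)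
qed

section \<open>Orbits through the towers\<close>

lemma stack_climb:
  assumes st: "stack f X l h u" and x: "in_level l h u \<gamma> j x" and i: "j + i \<le> h \<gamma>"
  shows "(f ^^ i) x = x + (u \<gamma> (j + i) - u \<gamma> j)"
  using i
proof (induction i)
  case (Suc i)
  then have "(f ^^ i) x = x + (u \<gamma> (j + i) - u \<gamma> j)" by simp
  moreover have "in_level l h u \<gamma> (j + i) ((f ^^ i) x)"
    using Suc x by (simp add: in_level_def)
  ultimately show ?case using stack_map[OF st] by fastforce
qed simp

text \<open>Each step of an orbit either climbs one level or leaves a top level and falls back into
  the base, so the level is bounded by the number of steps.\<close>

lemma stack_level_le:
  assumes st: "stack f X l h u" and h: "\<And>\<gamma>. 0 < h \<gamma>"
    and base: "\<And>y. y \<in> B \<longleftrightarrow> (\<exists>\<gamma>. in_level l h u \<gamma> 0 y)"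
    and top: "\<And>\<gamma> y. u \<gamma> (h \<gamma>) \<le> y \<Longrightarrow> y < u \<gamma> (h \<gamma>) + l \<gamma> \<Longrightarrow> y \<in> B"
    and inv: "\<And>x. x \<in> X \<Longrightarrow> f x \<in> X" and y: "y \<in> B"
  shows "in_level l h u \<gamma> j ((f ^^ i) y) \<Longrightarrow> j \<le> i"
proof (induction i arbitrary: \<gamma> j)
  case 0
  then show ?case using y base stack_unique[OF st] by fastforce
next
  case (Suc i)
  have "y \<in> X" using y base stack_subset[OF st] by blast
  then have "(f ^^ i) y \<in> X" by (induction i) (use inv in auto)
  then obtain \<delta> k where k: "in_level l h u \<delta> k ((f ^^ i) y)" using stack_cover[OF st] by blast
  then have "k \<le> i" using Suc.IH by blast
  show ?case
  proof (cases "Suc k < h \<delta>")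
    case True
    then have "in_level l h u \<delta> (Suc k) ((f ^^ Suc i) y)"
      using k stack_map[OF st k] by (auto simp: in_level_def)
    then show ?thesis using Suc.prems stack_unique[OF st] \<open>k \<le> i\<close> by fastforce
  next
    case False
    then have "Suc k = h \<delta>" using k by (auto simp: in_level_def)
    then have "(f ^^ Suc i) y \<in> B"
      using k stack_map[OF st k] by (intro top[of \<delta>]) (auto simp: in_level_def)
    then obtain \<epsilon> where "in_level l h u \<epsilon> 0 ((f ^^ Suc i) y)" using base by blast
    then show ?thesis using Suc.prems stack_unique[OF st] by fastforce
  qed
qed

text \<open>To come back to level \<open>j\<close>, an orbit must leave through the top, which takes
  \<open>h \<gamma> - j\<close> steps and lands in the base, and then climb \<open>j\<close> levels
  again, which takes at least \<open>j\<close> steps.\<close>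

lemma stack_return:
  assumes st: "stack f X l h u" and h: "\<And>\<gamma>. 0 < h \<gamma>"
    and base: "\<And>y. y \<in> B \<longleftrightarrow> (\<exists>\<gamma>. in_level l h u \<gamma> 0 y)"
    and top: "\<And>\<gamma> y. u \<gamma> (h \<gamma>) \<le> y \<Longrightarrow> y < u \<gamma> (h \<gamma>) + l \<gamma> \<Longrightarrow> y \<in> B"
    and inv: "\<And>x. x \<in> X \<Longrightarrow> f x \<in> X"
    and x: "in_level l h u \<gamma> j x" and i: "1 \<le> i" and fx: "in_level l h u \<gamma> j ((f ^^ i) x)"
  shows "h \<gamma> \<le> i"
proof (cases "i < h \<gamma> - j")
  case True
  have "in_level l h u \<gamma> (j + i) ((f ^^ i) x)"
    using True x stack_climb[OF st x, of i] by (auto simp: in_level_def)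
  then have "j = j + i" using stack_unique[OF st fx, of \<gamma> "j + i"] by simp
  then show ?thesis using i by simp
next
  case False
  have j: "j < h \<gamma>" using x by (simp add: in_level_def)
  have "(f ^^ (h \<gamma> - j)) x \<in> B"
    using x j stack_climb[OF st x, of "h \<gamma> - j"] by (intro top[of \<gamma>]) (auto simp: in_level_def)
  moreover have "(f ^^ i) x = (f ^^ (i - (h \<gamma> - j))) ((f ^^ (h \<gamma> - j)) x)"
    using False fun_cong[OF funpow_add[of "i - (h \<gamma> - j)" "h \<gamma> - j" f], of x] by simp
  moreover have "j' \<le> i'" if "y \<in> B" "in_level l h u \<gamma>' j' ((f ^^ i') y)" for y \<gamma>' j' i'
    by (rule stack_level_le[OF st h base _ _ that]) (use top inv in auto)
  ultimately have "j \<le> i - (h \<gamma> - j)" using fx by simp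
  then show ?thesis using False j by linarith
qed

subsection \<open>Towers over a stage of the Rauzy--Veech algorithm\<close>

lemma left_sum_update_last:
  "(\<And>\<beta>. p \<beta> \<le> p w) \<Longrightarrow> left_sum p (l(w := c)) \<gamma> = left_sum p l \<gamma>"
  unfolding left_sum_def by (intro sum.cong) (auto simp: not_less[symmetric])

text \<open>Letters behind the winner \<open>w\<close> do not move: the loser \<open>x\<close> now
  precedes them, but \<open>w\<close> has become shorter by exactly \<open>l x\<close>. Only
  \<open>x\<close> itself gets a new left end, the new right end of \<open>w\<close>.\<close>

lemma left_sum_move_after:
  fixes p :: "'a::finite \<Rightarrow> nat"
  assumes inj: "inj p" and mx: "\<And>\<beta>. p \<beta> \<le> p x" and neq: "x \<noteq> w"
  shows "left_sum (move_after p x w) (l(w := l w - l x)) \<gamma> =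
    (if \<gamma> = x then left_sum p l w + (l w - l x) else left_sum p l \<gamma>)"
proof -
  have lt: "p \<beta> < p x" if "\<beta> \<noteq> x" for \<beta> using inj mx that by (metis inj_eq order_le_less)
  have eqD: "p \<beta> = p \<delta> \<longleftrightarrow> \<beta> = \<delta>" for \<beta> \<delta> using inj by (simp add: inj_eq)
  let ?q = "move_after p x w" and ?l = "l(w := l w - l x)"
  consider "\<gamma> = x" | "\<gamma> \<noteq> x" "p \<gamma> \<le> p w" | "\<gamma> \<noteq> x" "p w < p \<gamma>" by linarith
  then show ?thesis
  proof cases
    case 1
    have "{\<beta>. ?q \<beta> < ?q x} = insert w {\<beta>. p \<beta> < p w}"
      using neq lt[of w] eqD by (auto simp: move_after_def less_Suc_eq split: if_splits)
    moreover have "sum ?l {\<beta>. p \<beta> < p w} = sum l {\<beta>. p \<beta> < p w}" by (intro sum.cong) auto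
    ultimately show ?thesis using 1 by (simp add: left_sum_def)
  next
    case 2
    have "{\<beta>. ?q \<beta> < ?q \<gamma>} = {\<beta>. p \<beta> < p \<gamma>}"
      using 2 lt[of w] lt[of \<gamma>] neq by (auto simp: move_after_def split: if_splits)
    moreover have "sum ?l {\<beta>. p \<beta> < p \<gamma>} = sum l {\<beta>. p \<beta> < p \<gamma>}"
      using 2 by (intro sum.cong) auto
    ultimately show ?thesis using 2 by (simp add: left_sum_def)
  next
    case 3
    have *: "{\<beta>. ?q \<beta> < ?q \<gamma>} = insert x {\<beta>. p \<beta> < p \<gamma>}"
    proof (intro set_eqI iffI; clarsimp)
      fix \<beta> assume "?q \<beta> < ?q \<gamma>" "\<not> p \<beta> < p \<gamma>"
      then show "\<beta> = x" using 3 lt[of \<beta>] lt[of \<gamma>] by (auto simp: move_after_def split: if_splits)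
    next
      fix \<beta> assume "\<beta> = x \<or> p \<beta> < p \<gamma>"
      then show "?q \<beta> < ?q \<gamma>" using 3 lt[of \<beta>] lt[of \<gamma>] by (auto simp: move_after_def)
    qed
    have "x \<notin> {\<beta>. p \<beta> < p \<gamma>}" using mx[of \<gamma>] by auto
    moreover have "sum ?l {\<beta>. p \<beta> < p \<gamma>} = sum l {\<beta>. p \<beta> < p \<gamma>} - l x"
      using 3 sum.remove[of "{\<beta>. p \<beta> < p \<gamma>}" w ?l] sum.remove[of "{\<beta>. p \<beta> < p \<gamma>}" w l]
      by (simp add: sum.cong[of "{\<beta>. p \<beta> < p \<gamma>} - {w}" _ ?l l])
    ultimately show ?thesis using 3 neq unfolding left_sum_def * by simp
  qed
qed

lemma the_last_position:
  fixes p :: "'a::finite \<Rightarrow> nat"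
  assumes "bij_betw p UNIV {1..CARD('a)}"
  shows "p (THE \<alpha>. p \<alpha> = CARD('a)) = CARD('a)"
proof -
  have "CARD('a) \<in> p ` UNIV" using assms by (auto simp: bij_betw_def Suc_le_eq)
  then obtain \<alpha> where \<alpha>: "p \<alpha> = CARD('a)" by auto
  moreover have "\<beta> = \<alpha>" if "p \<beta> = CARD('a)" for \<beta>
    using assms \<alpha> that by (metis bij_betw_def injD)
  ultimately show ?thesis by (rule theI)
qed

lemma pi_last:
  fixes T :: "'a::finite iet"
  assumes "is_iet T"
  shows "pi_t T \<beta> \<le> pi_t T (last_t T)" "pi_b T \<beta> \<le> pi_b T (last_b T)"
  using the_last_position[OF is_ietD(5)[OF assms]] the_last_position[OF is_ietD(6)[OF assms]]
    bij_betw_apply[OF is_ietD(5)[OF assms], of \<beta>] bij_betw_apply[OF is_ietD(6)[OF assms], of \<beta>]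
  by (simp_all add: last_t_def last_b_def)

text \<open>Level \<open>k \<gamma>\<close> of the tower over \<open>\<gamma>\<close> is the one that starts at the left end of the interval
  \<open>\<gamma>\<close> of the original map.\<close>

definition towers :: "'a::finite iet \<Rightarrow> 'a iet \<Rightarrow> ('a \<Rightarrow> nat) \<Rightarrow> ('a \<Rightarrow> nat) \<Rightarrow> ('a \<Rightarrow> nat \<Rightarrow> real) \<Rightarrow> bool" where
  "towers T S h k u \<longleftrightarrow> is_iet S \<and> stack (iet_map T) {0..<total_len T} (len S) h u \<and>
     (\<forall>\<gamma>. u \<gamma> 0 = left_end S \<gamma> \<and> u \<gamma> (h \<gamma>) = left_sum (pi_b S) (len S) \<gamma> \<and>
          k \<gamma> < h \<gamma> \<and> u \<gamma> (k \<gamma>) = left_end T \<gamma>) \<and>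
     (\<Sum>\<gamma>\<in>UNIV. real (h \<gamma>) * len S \<gamma>) = total_len T"

lemma towers_init:
  assumes T: "is_iet T"
  shows "towers T T (\<lambda>_. 1) (\<lambda>_. 0) (\<lambda>\<gamma> j. if j = 0 then left_end T \<gamma> else left_sum (pi_b T) (len T) \<gamma>)"
proof -
  have "stack (iet_map T) {0..<total_len T} (len T) (\<lambda>_. 1) (\<lambda>\<gamma> j. if j = 0 then left_end T \<gamma> else left_sum (pi_b T) (len T) \<gamma>)"
    unfolding stack_def
  proof (intro conjI allI impI, goal_cases)
    case (1 \<gamma> j x)
    then have "j = 0" "left_end T \<gamma> \<le> x" "x < left_end T \<gamma> + len T \<gamma>"
      by (auto simp: in_level_def)
    then show ?case using iet_map_eq[OF T, of \<gamma> x]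
      by (simp add: translation_eq_left_sum left_end_eq_left_sum)
  next
    case (2 x)
    show ?case
    proof
      assume "x \<in> {0..<total_len T}"
      then obtain \<gamma> where "left_end T \<gamma> \<le> x" "x < left_end T \<gamma> + len T \<gamma>"
        using iet_interval_exists[OF T, of x] by auto
      then show "\<exists>\<gamma> j. in_level (len T) (\<lambda>_. 1) (\<lambda>\<gamma> j. if j = 0 then left_end T \<gamma> else left_sum (pi_b T) (len T) \<gamma>) \<gamma> j x"
        by (auto simp: in_level_def)
    next
      assume "\<exists>\<gamma> j. in_level (len T) (\<lambda>_. 1) (\<lambda>\<gamma> j. if j = 0 then left_end T \<gamma> else left_sum (pi_b T) (len T) \<gamma>) \<gamma> j x"
      then obtain \<gamma> where "left_end T \<gamma> \<le> x" "x < left_end T \<gamma> + len T \<gamma>"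
        by (auto simp: in_level_def)
      then show "x \<in> {0..<total_len T}"
        using left_sum_nonneg[of "len T" "pi_t T" \<gamma>] left_sum_add_le_total[of "len T" "pi_t T" \<gamma>] is_ietD(4)[OF T]
        by (auto simp: left_end_eq_left_sum total_len_def)
    qed
  next
    case (3 \<gamma> j \<gamma>' j' x)
    then show ?case by (auto simp: in_level_def left_end_eq_left_sum intro: iet_top_unique[OF T, where y=x])
  next
    case (4 \<gamma> j \<gamma>' j' x)
    then show ?case by (simp add: in_level_def)
  qed
  then show ?thesis using T by (simp add: towers_def total_len_def)
qed

lemma sum_split_two:
  fixes f :: "'a::finite \<Rightarrow> real"
  assumes "x \<noteq> w"
  shows "sum f UNIV = f x + f w + sum f (UNIV - {x, w})"
proof -
  have "UNIV = insert x (insert w (UNIV - {x, w}))" by auto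
  then have "sum f UNIV = sum f (insert x (insert w (UNIV - {x, w})))" by simp
  also have "\<dots> = f x + f w + sum f (UNIV - {x, w})" using assms by (simp add: add.assoc)
  finally show ?thesis .
qed

text \<open>The type decides where the winner's column goes, hence the marked level
  \<open>k\<close>: put on top of the loser (top type) it leaves \<open>k\<close> alone, put
  underneath (bottom type) it lifts the mark of the loser by the winner's height.\<close>

lemma towers_step:
  assumes tw: "towers T S h k u" and S': "is_iet (rv_step S)" and less: "len S (loser S) < len S (winner S)"
  shows "\<exists>u'. towers T (rv_step S) (h(loser S := h (loser S) + h (winner S)))
    (if top_type S then k else k(loser S := h (winner S) + k (loser S))) u'"
proof -
  define w x where "w = winner S" and "x = loser S"
  have S: "is_iet S" and st: "stack (iet_map T) {0..<total_len T} (len S) h u"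
    and u0: "\<And>\<gamma>. u \<gamma> 0 = left_end S \<gamma>" and uh: "\<And>\<gamma>. u \<gamma> (h \<gamma>) = left_sum (pi_b S) (len S) \<gamma>"
    and kh: "\<And>\<gamma>. k \<gamma> < h \<gamma>" and uk: "\<And>\<gamma>. u \<gamma> (k \<gamma>) = left_end T \<gamma>"
    and sum: "(\<Sum>\<gamma>\<in>UNIV. real (h \<gamma>) * len S \<gamma>) = total_len T"
    using tw by (auto simp: towers_def)
  have neq: "x \<noteq> w" and less': "len S x < len S w" using less by (auto simp: w_def x_def)
  have pos: "0 < len S x" using S by (rule is_ietD)
  have len': "len (rv_step S) = (len S)(w := len S w - len S x)" by (simp add: rv_step_def w_def x_def)
  have sum': "(\<Sum>\<gamma>\<in>UNIV. real ((h(x := h x + h w)) \<gamma>) * len (rv_step S) \<gamma>) = total_len T"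
  proof -
    have "(\<Sum>\<gamma>\<in>UNIV - {x, w}. real ((h(x := h x + h w)) \<gamma>) * len (rv_step S) \<gamma>)
        = (\<Sum>\<gamma>\<in>UNIV - {x, w}. real (h \<gamma>) * len S \<gamma>)"
      by (intro sum.cong) (auto simp: len')
    then show ?thesis
      using sum neq unfolding sum_split_two[OF neq] len' by (simp add: algebra_simps)
  qed
  show ?thesis
  proof (cases "top_type S")
    case True
    have w: "w = last_t S" and x: "x = last_b S" using True by (auto simp: w_def x_def winner_def loser_def)
    have pt: "pi_t (rv_step S) = pi_t S" and pb: "pi_b (rv_step S) = move_after (pi_b S) x w"
      using True by (auto simp: rv_step_def w x)
    have "left_end S w + len S w = sum (len S) UNIV"
      unfolding left_end_eq_left_sum by (intro left_sum_add_eq_total is_ietD(1)[OF S]) (simp add: w pi_last[OF S])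
    moreover have "left_sum (pi_b S) (len S) x + len S x = sum (len S) UNIV"
      by (intro left_sum_add_eq_total is_ietD(2)[OF S]) (simp add: x pi_last[OF S])
    ultimately have joint: "u x (h x) = u w 0 + (len S w - len S x)" by (simp add: u0 uh)
    let ?u = "u(x := (\<lambda>j. if j < h x then u x j else u w (j - h x) + (len S w - len S x)))"
    have lt: "left_end (rv_step S) \<gamma> = left_end S \<gamma>" for \<gamma>
      unfolding left_end_eq_left_sum pt len' by (rule left_sum_update_last) (simp add: w pi_last[OF S])
    have lb: "left_sum (pi_b (rv_step S)) (len (rv_step S)) \<gamma> =
        (if \<gamma> = x then left_sum (pi_b S) (len S) w + (len S w - len S x) else left_sum (pi_b S) (len S) \<gamma>)" for \<gamma>
      unfolding pb len' by (rule left_sum_move_after[OF is_ietD(2)[OF S] _ neq]) (simp add: x pi_last[OF S])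
    have "towers T (rv_step S) (h(x := h x + h w)) k ?u"
      unfolding towers_def
    proof (intro conjI allI)
      show "stack (iet_map T) {0..<total_len T} (len (rv_step S)) (h(x := h x + h w)) ?u"
        unfolding len' by (rule stack_top[OF st neq less' pos joint])
      fix \<gamma>
      show "?u \<gamma> 0 = left_end (rv_step S) \<gamma>" using kh[of x] by (simp add: lt u0)
      show "?u \<gamma> ((h(x := h x + h w)) \<gamma>) = left_sum (pi_b (rv_step S)) (len (rv_step S)) \<gamma>"
        by (simp add: lb uh)
      show "k \<gamma> < (h(x := h x + h w)) \<gamma>" using kh[of \<gamma>] by auto
      show "?u \<gamma> (k \<gamma>) = left_end T \<gamma>" using kh[of \<gamma>] uk[of \<gamma>] by auto
    qed (use S' sum' in auto)
    then show ?thesis using True by (auto simp: w_def x_def)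
  next
    case False
    have w: "w = last_b S" and x: "x = last_t S" using False by (auto simp: w_def x_def winner_def loser_def)
    have pb: "pi_b (rv_step S) = pi_b S" and pt: "pi_t (rv_step S) = move_after (pi_t S) x w"
      using False by (auto simp: rv_step_def w x)
    have "left_end S x + len S x = sum (len S) UNIV"
      unfolding left_end_eq_left_sum by (intro left_sum_add_eq_total is_ietD(1)[OF S]) (simp add: x pi_last[OF S])
    moreover have "left_sum (pi_b S) (len S) w + len S w = sum (len S) UNIV"
      by (intro left_sum_add_eq_total is_ietD(2)[OF S]) (simp add: w pi_last[OF S])
    ultimately have joint: "u w (h w) + (len S w - len S x) = u x 0" by (simp add: u0 uh)
    let ?u = "u(x := (\<lambda>j. if j < h w then u w j + (len S w - len S x) else u x (j - h w)))"
    have lb: "left_sum (pi_b (rv_step S)) (len (rv_step S)) \<gamma> = left_sum (pi_b S) (len S) \<gamma>" for \<gamma>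
      unfolding pb len' by (rule left_sum_update_last) (simp add: w pi_last[OF S])
    have lt: "left_end (rv_step S) \<gamma> =
        (if \<gamma> = x then left_end S w + (len S w - len S x) else left_end S \<gamma>)" for \<gamma>
      unfolding left_end_eq_left_sum pt len'
      by (rule left_sum_move_after[OF is_ietD(1)[OF S] _ neq]) (simp add: x pi_last[OF S])
    have "towers T (rv_step S) (h(x := h x + h w)) (k(x := h w + k x)) ?u"
      unfolding towers_def
    proof (intro conjI allI)
      show "stack (iet_map T) {0..<total_len T} (len (rv_step S)) (h(x := h x + h w)) ?u"
        unfolding len' by (rule stack_bottom[OF st neq less' pos joint])
      fix \<gamma>
      show "?u \<gamma> 0 = left_end (rv_step S) \<gamma>" using kh[of w] by (simp add: lt u0)
      show "?u \<gamma> ((h(x := h x + h w)) \<gamma>) = left_sum (pi_b (rv_step S)) (len (rv_step S)) \<gamma>"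
        by (simp add: lb uh)
      show "(k(x := h w + k x)) \<gamma> < (h(x := h x + h w)) \<gamma>" using kh[of \<gamma>] by auto
      show "?u \<gamma> ((k(x := h w + k x)) \<gamma>) = left_end T \<gamma>" using uk[of \<gamma>] by auto
    qed (use S' sum' in auto)
    then show ?thesis using False by (auto simp: w_def x_def)
  qed
qed

text \<open>The margin \<open>r\<close> on both sides keeps a point within distance \<open>r\<close>
  of \<open>x\<close> on the same level, so \<open>stack_return\<close> applies.\<close>

lemma towers_return:
  assumes T: "is_iet T" and tw: "towers T S h k u"
    and x: "j < h \<gamma>" "u \<gamma> j + r \<le> x" "x \<le> u \<gamma> j + len S \<gamma> - r"
    and i: "1 \<le> i" "\<bar>(iet_map T ^^ i) x - x\<bar> < r"
  shows "h \<gamma> \<le> i"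
proof -
  have S: "is_iet S" and st: "stack (iet_map T) {0..<total_len T} (len S) h u"
    and u0: "\<And>\<gamma>. u \<gamma> 0 = left_end S \<gamma>" and uh: "\<And>\<gamma>. u \<gamma> (h \<gamma>) = left_sum (pi_b S) (len S) \<gamma>"
    and h: "\<And>\<gamma>. 0 < h \<gamma>"
    using tw unfolding towers_def by (auto dest: le_less_trans[OF le0])
  have *: "in_level (len S) h u \<gamma> j x" "in_level (len S) h u \<gamma> j ((iet_map T ^^ i) x)"
    using x i by (auto simp: in_level_def)
  show ?thesis
  proof (rule stack_return[OF st h _ _ _ *(1) i(1) *(2)])
    show "y \<in> {0..<total_len S} \<longleftrightarrow> (\<exists>\<gamma>. in_level (len S) h u \<gamma> 0 y)" for y
    proof
      assume "y \<in> {0..<total_len S}"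
      then show "\<exists>\<gamma>. in_level (len S) h u \<gamma> 0 y"
        using iet_interval_exists[OF S, of y] h by (auto simp: in_level_def u0)
    next
      assume "\<exists>\<gamma>. in_level (len S) h u \<gamma> 0 y"
      then show "y \<in> {0..<total_len S}"
        using left_sum_nonneg[of "len S" "pi_t S"] left_sum_add_le_total[of "len S" "pi_t S"] is_ietD(4)[OF S]
        by (fastforce simp: in_level_def u0 total_len_def left_end_eq_left_sum intro: order_trans less_le_trans)
    qed
    show "y \<in> {0..<total_len S}" if "u \<gamma> (h \<gamma>) \<le> y" "y < u \<gamma> (h \<gamma>) + len S \<gamma>" for \<gamma> y
      using that left_sum_nonneg[of "len S" "pi_b S" \<gamma>] left_sum_add_le_total[of "len S" "pi_b S" \<gamma>] is_ietD(4)[OF S]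
      by (auto simp: uh total_len_def)
    show "iet_map T x \<in> {0..<total_len T}" if "x \<in> {0..<total_len T}" for x
      using iet_map_range[OF T] that by auto
  qed
qed

text \<open>If the left end of \<beta> lies at least \<open>m\<close> levels up in its tower, then
  its unique preimage under \<open>m\<close> steps lies \<open>m\<close> levels lower in the same
  tower. A connection would make this the left end of some \<alpha>; uniqueness of levels forces
  \<alpha> = \<beta>, but the marked level of \<beta> is \<open>k \<beta>\<close> and not
  \<open>k \<beta> - m\<close>.\<close>

lemma keaneI:
  assumes T: "is_iet T"
    and tw: "\<And>\<beta> m. 1 < pi_t T \<beta> \<Longrightarrow> \<exists>S h k u. towers T S h k u \<and> m \<le> k \<beta>"
  shows "keane T"
  unfolding keane_def
proof safe
  fix \<alpha> \<beta> m assume m: "1 \<le> m" "(iet_map T ^^ m) (left_end T \<alpha>) = left_end T \<beta>" "1 < pi_t T \<beta>"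
  obtain S h k u where tw: "towers T S h k u" and km: "m \<le> k \<beta>" using tw m by blast
  have st: "stack (iet_map T) {0..<total_len T} (len S) h u" and S: "is_iet S"
    and kh: "\<And>\<gamma>. k \<gamma> < h \<gamma>" and uk: "\<And>\<gamma>. u \<gamma> (k \<gamma>) = left_end T \<gamma>"
    using tw by (auto simp: towers_def)
  let ?y = "u \<beta> (k \<beta> - m)"
  have y: "in_level (len S) h u \<beta> (k \<beta> - m) ?y" using kh[of \<beta>] is_ietD(3)[OF S, of \<beta>] by (auto simp: in_level_def)
  have a: "in_level (len S) h u \<alpha> (k \<alpha>) (left_end T \<alpha>)"
    using kh[of \<alpha>] is_ietD(3)[OF S, of \<alpha>] uk by (auto simp: in_level_def)
  have eq: "(iet_map T ^^ m) ?y = (iet_map T ^^ m) (left_end T \<alpha>)"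
    using stack_climb[OF st y, of m] kh[of \<beta>] km uk[of \<beta>] m(2) by simp
  have "?y = left_end T \<alpha>"
    by (rule iet_map_funpow_inj[OF T _ _ _ _ eq]) (use stack_subset[OF st y] stack_subset[OF st a] in simp_all)
  then have "\<alpha> = \<beta> \<and> k \<alpha> = k \<beta> - m" using a y stack_unique[OF st] by metis
  then show False using m(1) km by auto
qed

section \<open>Return times\<close>

lemma emeasure_UN_le:
  fixes A :: "'i \<Rightarrow> real set"
  assumes "finite I" "\<And>i. i \<in> I \<Longrightarrow> A i \<in> sets borel" "\<And>i. i \<in> I \<Longrightarrow> emeasure lborel (A i) \<le> ennreal (c i)" "\<And>i. i \<in> I \<Longrightarrow> 0 \<le> c i"
  shows "emeasure lborel (\<Union>i\<in>I. A i) \<le> ennreal (\<Sum>i\<in>I. c i)"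
proof -
  have "emeasure lborel (\<Union>i\<in>I. A i) \<le> (\<Sum>i\<in>I. emeasure lborel (A i))"
    using assms by (intro emeasure_subadditive_finite) auto
  also have "\<dots> \<le> (\<Sum>i\<in>I. ennreal (c i))" using assms by (intro sum_mono)
  also have "\<dots> = ennreal (\<Sum>i\<in>I. c i)" using assms by (intro sum_ennreal)
  finally show ?thesis .
qed

lemma AE_eventually_notin:
  fixes A :: "nat \<Rightarrow> real set"
  assumes "\<And>n. A n \<in> sets borel" "\<And>n. emeasure lborel (A n) \<le> ennreal (c n)" "\<And>n. 0 \<le> c n" "summable c"
  shows "AE x in lborel. \<forall>\<^sub>F n in sequentially. x \<notin> A n"
proof -
  have fin: "emeasure lborel (A n) < \<infinity>" for n
    using assms(2)[of n] by (metis ennreal_less_top infinity_ennreal_def le_less_trans)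
  have "measure lborel (A n) \<le> c n" for n
    using assms(2,3)[of n] fin[of n] by (simp add: emeasure_eq_ennreal_measure less_top[symmetric])
  then have "summable (\<lambda>n. measure lborel (A n))"
    using assms(4) by (intro summable_comparison_test'[OF assms(4), of 0]) auto
  then have "AE x in lborel. \<forall>\<^sub>F n in sequentially. x \<in> space lborel - A n"
    using assms(1) fin by (intro borel_cantelli_AE1) auto
  then show ?thesis by simp
qed

lemma two_powr_minus_less_1: "0 < a \<Longrightarrow> 2 powr (- a) < (1::real)"
  using powr_less_mono[of "- a" 0 2] by simp

subsection \<open>Upper bound for the return time\<close>

text \<open>Kac's argument on each of the \<open>2 ^ n\<close> dyadic intervals
  \<open>J n i\<close>: the points that do not return to it within \<open>N n\<close> steps have
  measure at most 2^(-n(1+\<epsilon>)). Summed over \<open>i\<close> this is 2^(-n\<epsilon>), which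
  is summable in \<open>n\<close>, and a return to \<open>J n i\<close> is a return within its
  length.\<close>

lemma AE_return_time_upper:
  assumes T: "is_iet T" and tot: "total_len T = 1" and \<epsilon>: "0 < \<epsilon>"
  shows "AE x in lborel. 0 \<le> x \<and> x < 1 \<longrightarrow> (\<forall>\<^sub>F n in sequentially.
    \<exists>j\<ge>1. real j \<le> 2 * 2 powr (real n * (1 + \<epsilon>)) \<and> \<bar>(iet_map T ^^ j) x - x\<bar> < 2 powr (- real n))"
proof -
  define N where "N n = nat \<lceil>2 powr (real n * (1 + \<epsilon>))\<rceil>" for n
  define J where "J n i = {real i * 2 powr (- real n) ..< (real i + 1) * 2 powr (- real n)} \<inter> {0..<1}" for n i :: nat
  define E where "E n i = {x \<in> J n i. \<forall>j\<in>{1..N n}. (iet_map T ^^ j) x \<notin> J n i}" for n i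
  define A where "A n = (\<Union>i\<in>{..<2 ^ n}. E n i)" for n
  have J: "J n i \<in> sets borel" for n i by (simp add: J_def)
  have E: "E n i \<in> sets borel" for n i
  proof -
    have "E n i = J n i - (\<Union>j\<in>{1..N n}. (iet_map T ^^ j) -` J n i)" by (auto simp: E_def)
    moreover have "(iet_map T ^^ j) -` J n i \<in> sets borel" for j
      by (rule measurable_sets_borel[OF iet_map_funpow_measurable J])
    ultimately show ?thesis using J[of n i] by auto
  qed
  have N: "2 powr (real n * (1 + \<epsilon>)) \<le> real (N n)" "real (N n) \<le> 2 * 2 powr (real n * (1 + \<epsilon>))" for n
  proof -
    have "1 \<le> 2 powr (real n * (1 + \<epsilon>))" using \<epsilon> by (intro ge_one_powr_ge_zero) auto
    then show "2 powr (real n * (1 + \<epsilon>)) \<le> real (N n)" "real (N n) \<le> 2 * 2 powr (real n * (1 + \<epsilon>))"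
      unfolding N_def by linarith+
  qed
  have mE: "emeasure lborel (E n i) \<le> ennreal (2 powr (- (real n * (1 + \<epsilon>))))" for n i
  proof -
    have "of_nat (Suc (N n)) * emeasure lborel (E n i) \<le> ennreal (total_len T)"
    proof (rule emeasure_no_return[OF T E])
      show "E n i \<subseteq> {0..<total_len T}" unfolding E_def J_def tot by blast
      show "(iet_map T ^^ j) x \<notin> E n i" if "x \<in> E n i" "1 \<le> j" "j \<le> N n" for x j
        using that unfolding E_def by auto
    qed
    then have 1: "of_nat (Suc (N n)) * emeasure lborel (E n i) \<le> 1" by (simp add: tot)
    have "emeasure lborel (E n i) \<le> emeasure lborel {0..<1::real}"
      using E by (intro emeasure_mono) (unfold E_def J_def, blast, simp)
    then have fin: "emeasure lborel (E n i) < top" by (auto intro: le_less_trans)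
    define e where "e = measure lborel (E n i)"
    have e: "emeasure lborel (E n i) = ennreal e" "0 \<le> e"
      using fin by (auto simp: e_def emeasure_eq_ennreal_measure)
    have "ennreal (real (Suc (N n)) * e) \<le> ennreal 1"
      using 1 e by (simp add: ennreal_mult ennreal_of_nat_eq_real_of_nat del: of_nat_Suc)
    then have "real (Suc (N n)) * e \<le> 1" by (simp del: of_nat_Suc)
    moreover have "2 powr (real n * (1 + \<epsilon>)) * e \<le> real (Suc (N n)) * e"
      using N(1)[of n] by (intro mult_right_mono e) simp
    ultimately have "2 powr (real n * (1 + \<epsilon>)) * e \<le> 1" by linarith
    then have "e \<le> 2 powr (- (real n * (1 + \<epsilon>)))"
      unfolding powr_minus by (simp add: inverse_eq_divide pos_le_divide_eq mult.commute)
    then show ?thesis using e by (simp add: ennreal_leI)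
  qed
  have mA: "emeasure lborel (A n) \<le> ennreal ((2 powr (- \<epsilon>)) ^ n)" for n
  proof -
    have "emeasure lborel (A n) \<le> ennreal (\<Sum>i\<in>{..<2^n::nat}. 2 powr (- (real n * (1 + \<epsilon>))))"
      unfolding A_def using E mE by (intro emeasure_UN_le) auto
    also have "(\<Sum>i\<in>{..<2^n::nat}. 2 powr (- (real n * (1 + \<epsilon>)))) = 2 powr (real n) * 2 powr (- (real n * (1 + \<epsilon>)))"
      by (simp add: powr_realpow)
    also have "\<dots> = (2 powr (- \<epsilon>)) ^ n"
      by (simp add: powr_add[symmetric] powr_realpow[symmetric] powr_powr algebra_simps)
    finally show ?thesis .
  qed
  have "AE x in lborel. \<forall>\<^sub>F n in sequentially. x \<notin> A n"
  proof (rule AE_eventually_notin[OF _ mA])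
    show "A n \<in> sets borel" for n unfolding A_def using E by auto
    show "summable (\<lambda>n. (2 powr (- \<epsilon>)) ^ n)" using \<epsilon> by (intro summable_geometric) (simp add: two_powr_minus_less_1)
  qed simp
  then show ?thesis
  proof (eventually_elim, intro impI)
    fix x assume ev: "\<forall>\<^sub>F n in sequentially. x \<notin> A n" and x: "0 \<le> x \<and> x < 1"
    from ev show "\<forall>\<^sub>F n in sequentially. \<exists>j\<ge>1. real j \<le> 2 * 2 powr (real n * (1 + \<epsilon>)) \<and> \<bar>(iet_map T ^^ j) x - x\<bar> < 2 powr (- real n)"
    proof eventually_elim
      fix n assume n: "x \<notin> A n"
      define i where "i = nat \<lfloor>x * 2 powr real n\<rfloor>"
      have i: "real i \<le> x * 2 powr real n" "x * 2 powr real n < real i + 1"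
      proof -
        have "0 \<le> x * 2 powr real n" using x by simp
        then show "real i \<le> x * 2 powr real n" "x * 2 powr real n < real i + 1" unfolding i_def by linarith+
      qed
      have "x * 2 powr real n < 2 powr real n" using x by simp
      then have "real i < 2 powr real n" using i by linarith
      then have "real i < 2 ^ n" by (simp only: powr_realpow zero_less_numeral)
      then have i2: "i < 2 ^ n" by (metis of_nat_less_iff of_nat_numeral of_nat_power)
      have xJ: "x \<in> J n i" using i x by (auto simp: J_def powr_minus field_simps)
      moreover have "x \<notin> E n i" using n i2 unfolding A_def by blast
      ultimately obtain j where j: "1 \<le> j" "j \<le> N n" "(iet_map T ^^ j) x \<in> J n i"
        unfolding E_def by auto
      have "\<bar>(iet_map T ^^ j) x - x\<bar> < 2 powr (- real n)"
        using xJ j(3) by (auto simp: J_def algebra_simps abs_if)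
      moreover have "real j \<le> 2 * 2 powr (real n * (1 + \<epsilon>))" using N(2)[of n] j(2) by linarith
      ultimately show "\<exists>j\<ge>1. real j \<le> 2 * 2 powr (real n * (1 + \<epsilon>)) \<and> \<bar>(iet_map T ^^ j) x - x\<bar> < 2 powr (- real n)"
        using j(1) by blast
    qed
  qed
qed

subsection \<open>Lower bound for the return time\<close>

text \<open>The exceptional set is the whole tower over \<alpha> together with strips of width
  \<open>r\<close> at both ends of every level of every tower. Outside of it
  \<open>towers_return\<close> applies in a tower other than that over \<alpha>.\<close>

lemma towers_return_measure:
  assumes T: "is_iet T" and tw: "towers T S h k u" and r: "0 < r"
  obtains A where "A \<in> sets borel"
    "emeasure lborel A \<le> ennreal (real (h \<alpha>) * len S \<alpha> + 2 * r * (\<Sum>\<gamma>\<in>UNIV. real (h \<gamma>)))"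
    "\<And>x. 0 \<le> x \<Longrightarrow> x < total_len T \<Longrightarrow> x \<notin> A \<Longrightarrow> \<exists>\<gamma>. \<gamma> \<noteq> \<alpha> \<and> (\<forall>i\<ge>1. \<bar>(iet_map T ^^ i) x - x\<bar> < r \<longrightarrow> h \<gamma> \<le> i)"
proof -
  have S: "is_iet S" and st: "stack (iet_map T) {0..<total_len T} (len S) h u" using tw by (auto simp: towers_def)
  define A1 where "A1 = (\<Union>j\<in>{..<h \<alpha>}. {u \<alpha> j ..< u \<alpha> j + len S \<alpha>})"
  define A2 where "A2 = (\<Union>\<gamma>\<in>UNIV. \<Union>j\<in>{..<h \<gamma>}. {u \<gamma> j .. u \<gamma> j + r} \<union> {u \<gamma> j + len S \<gamma> - r .. u \<gamma> j + len S \<gamma>})"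
  have m1: "emeasure lborel A1 \<le> ennreal (\<Sum>j\<in>{..<h \<alpha>}. len S \<alpha>)"
    unfolding A1_def using is_ietD(4)[OF S] by (intro emeasure_UN_le) auto
  have le: "emeasure lborel ({u \<gamma> j .. u \<gamma> j + r} \<union> {u \<gamma> j + len S \<gamma> - r .. u \<gamma> j + len S \<gamma>}) \<le> ennreal (2 * r)" for \<gamma> j
  proof -
    have "emeasure lborel ({u \<gamma> j .. u \<gamma> j + r} \<union> {u \<gamma> j + len S \<gamma> - r .. u \<gamma> j + len S \<gamma>}) \<le>
       emeasure lborel {u \<gamma> j .. u \<gamma> j + r} + emeasure lborel {u \<gamma> j + len S \<gamma> - r .. u \<gamma> j + len S \<gamma>}"
      by (intro emeasure_subadditive) auto
    also have "\<dots> = ennreal (2 * r)" using r by (simp flip: ennreal_plus)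
    finally show ?thesis .
  qed
  have m2: "emeasure lborel A2 \<le> ennreal (\<Sum>\<gamma>\<in>UNIV. \<Sum>j\<in>{..<h \<gamma>}. 2 * r)"
    unfolding A2_def using r by (intro emeasure_UN_le le sum_nonneg) auto
  have sets: "A1 \<in> sets borel" "A2 \<in> sets borel" unfolding A1_def A2_def by auto
  have "emeasure lborel (A1 \<union> A2) \<le> emeasure lborel A1 + emeasure lborel A2"
    using sets by (intro emeasure_subadditive) auto
  also have "\<dots> \<le> ennreal (\<Sum>j\<in>{..<h \<alpha>}. len S \<alpha>) + ennreal (\<Sum>\<gamma>\<in>UNIV. \<Sum>j\<in>{..<h \<gamma>}. 2 * r)"
    by (intro add_mono m1 m2)
  also have "\<dots> = ennreal (real (h \<alpha>) * len S \<alpha> + 2 * r * (\<Sum>\<gamma>\<in>UNIV. real (h \<gamma>)))"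
    using r is_ietD(4)[OF S] by (simp add: sum_nonneg sum_distrib_left mult.commute mult.left_commute flip: ennreal_plus)
  finally have m: "emeasure lborel (A1 \<union> A2) \<le> ennreal (real (h \<alpha>) * len S \<alpha> + 2 * r * (\<Sum>\<gamma>\<in>UNIV. real (h \<gamma>)))" .
  show ?thesis
  proof (rule that[of "A1 \<union> A2"])
    show "A1 \<union> A2 \<in> sets borel" using sets by auto
    fix x assume x: "0 \<le> x" "x < total_len T" "x \<notin> A1 \<union> A2"
    obtain \<gamma> j where j: "in_level (len S) h u \<gamma> j x" using stack_cover[OF st, of x] x by auto
    have "\<gamma> \<noteq> \<alpha>" using j x(3) by (auto simp: A1_def in_level_def)
    moreover have "x \<notin> {u \<gamma> j .. u \<gamma> j + r} \<union> {u \<gamma> j + len S \<gamma> - r .. u \<gamma> j + len S \<gamma>}"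
      using j x(3) unfolding A2_def in_level_def by blast
    then have "u \<gamma> j + r \<le> x" "x \<le> u \<gamma> j + len S \<gamma> - r" "j < h \<gamma>" using j by (auto simp: in_level_def)
    then have "h \<gamma> \<le> i" if "1 \<le> i" "\<bar>(iet_map T ^^ i) x - x\<bar> < r" for i
      using towers_return[OF T tw _ _ _ that] by blast
    ultimately show "\<exists>\<gamma>. \<gamma> \<noteq> \<alpha> \<and> (\<forall>i\<ge>1. \<bar>(iet_map T ^^ i) x - x\<bar> < r \<longrightarrow> h \<gamma> \<le> i)" by blast
  qed (rule m)
qed

text \<open>The interface between the construction and the lower bound for return times. The letter
  \<alpha>, which may depend on the scale \<open>y\<close>, is bounded through the area of its tower
  and may be arbitrarily low. All real scales are covered so that any sequence of them can be
  inserted.\<close>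

definition thin_towers :: "'a::finite iet \<Rightarrow> real \<Rightarrow> real \<Rightarrow> bool" where
  "thin_towers T C \<delta> \<longleftrightarrow> (\<forall>y\<ge>1. \<exists>S h k u \<alpha>. towers T S h k u \<and> (\<forall>\<gamma>. \<gamma> \<noteq> \<alpha> \<longrightarrow> y \<le> C * real (h \<gamma>)) \<and>
     (\<Sum>\<gamma>\<in>UNIV. real (h \<gamma>)) \<le> C * y \<and> real (h \<alpha>) * len S \<alpha> \<le> C * y powr (- \<delta>))"

text \<open>For the radius 2^(-n) the towers of the slightly smaller scale \<open>y\<close> =
  2^(n(1-\<epsilon>)) are used. The strips then have measure of order 2^(-n) \<open>y\<close> =
  2^(-n\<epsilon>) and the thin tower at most a constant times \<open>y\<close> to the power
  -\<delta>; both are summable.\<close>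

lemma AE_return_time_lower:
  assumes T: "is_iet T" and tot: "total_len T = 1" and thin: "thin_towers T C \<delta>" and "0 < C" "0 < \<delta>"
    and \<epsilon>: "0 < \<epsilon>" "\<epsilon> < 1"
  shows "AE x in lborel. 0 \<le> x \<and> x < 1 \<longrightarrow> (\<forall>\<^sub>F n in sequentially.
    \<forall>i\<ge>1. \<bar>(iet_map T ^^ i) x - x\<bar> < 2 powr (- real n) \<longrightarrow> 2 powr (real n * (1 - \<epsilon>)) \<le> C * real i)"
proof -
  let ?c = "\<lambda>n. C * (2 powr (- ((1 - \<epsilon>) * \<delta>))) ^ n + 2 * C * (2 powr (- \<epsilon>)) ^ n"
  have "\<exists>A. A \<in> sets borel \<and> emeasure lborel A \<le> ennreal (?c n) \<and>
    (\<forall>x. 0 \<le> x \<longrightarrow> x < 1 \<longrightarrow> x \<notin> A \<longrightarrow> (\<forall>i\<ge>1. \<bar>(iet_map T ^^ i) x - x\<bar> < 2 powr (- real n) \<longrightarrow> 2 powr (real n * (1 - \<epsilon>)) \<le> C * real i))" for n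
  proof -
    define y where "y = 2 powr (real n * (1 - \<epsilon>))"
    have "1 \<le> y" unfolding y_def using \<epsilon> by (intro ge_one_powr_ge_zero) auto
    then obtain S h k u \<alpha> where tw: "towers T S h k u" and hy: "\<And>\<gamma>. \<gamma> \<noteq> \<alpha> \<Longrightarrow> y \<le> C * real (h \<gamma>)"
      and s: "(\<Sum>\<gamma>\<in>UNIV. real (h \<gamma>)) \<le> C * y" and a: "real (h \<alpha>) * len S \<alpha> \<le> C * y powr (- \<delta>)"
      using thin unfolding thin_towers_def by metis
    obtain A where A: "A \<in> sets borel"
      "emeasure lborel A \<le> ennreal (real (h \<alpha>) * len S \<alpha> + 2 * 2 powr (- real n) * (\<Sum>\<gamma>\<in>UNIV. real (h \<gamma>)))"
      "\<And>x. 0 \<le> x \<Longrightarrow> x < total_len T \<Longrightarrow> x \<notin> A \<Longrightarrow> \<exists>\<gamma>. \<gamma> \<noteq> \<alpha> \<and> (\<forall>i\<ge>1. \<bar>(iet_map T ^^ i) x - x\<bar> < 2 powr (- real n) \<longrightarrow> h \<gamma> \<le> i)"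
      using towers_return_measure[OF T tw, of "2 powr (- real n)" \<alpha>] by auto
    have "2 * 2 powr (- real n) * (\<Sum>\<gamma>\<in>UNIV. real (h \<gamma>)) \<le> 2 * 2 powr (- real n) * (C * y)"
      using s by (intro mult_left_mono) auto
    also have "\<dots> = 2 * C * (2 powr (- \<epsilon>)) ^ n"
      by (simp add: y_def powr_add[symmetric] powr_realpow[symmetric] powr_powr algebra_simps)
    finally have "real (h \<alpha>) * len S \<alpha> + 2 * 2 powr (- real n) * (\<Sum>\<gamma>\<in>UNIV. real (h \<gamma>)) \<le> C * y powr (- \<delta>) + 2 * C * (2 powr (- \<epsilon>)) ^ n"
      using a by linarith
    also have "y powr (- \<delta>) = (2 powr (- ((1 - \<epsilon>) * \<delta>))) ^ n"
      by (simp add: y_def powr_realpow[symmetric] powr_powr algebra_simps)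
    finally have "emeasure lborel A \<le> ennreal (?c n)" using A(2) by (meson ennreal_leI order_trans)
    moreover have "y \<le> C * real i" if x: "0 \<le> x" "x < 1" "x \<notin> A" and i: "1 \<le> i" "\<bar>(iet_map T ^^ i) x - x\<bar> < 2 powr (- real n)" for x i
    proof -
      obtain \<gamma> where "\<gamma> \<noteq> \<alpha>" "h \<gamma> \<le> i" using A(3)[of x] x i by (auto simp: tot)
      then show ?thesis using hy[of \<gamma>] \<open>0 < C\<close> by (meson less_imp_le mult_left_mono of_nat_mono order_trans)
    qed
    ultimately show ?thesis using A(1) unfolding y_def by blast
  qed
  then obtain A where A: "\<And>n. A n \<in> sets borel" "\<And>n. emeasure lborel (A n) \<le> ennreal (?c n)"
    "\<And>n x i. 0 \<le> x \<Longrightarrow> x < 1 \<Longrightarrow> x \<notin> A n \<Longrightarrow> 1 \<le> i \<Longrightarrow> \<bar>(iet_map T ^^ i) x - x\<bar> < 2 powr (- real n) \<Longrightarrow> 2 powr (real n * (1 - \<epsilon>)) \<le> C * real i"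
    by metis
  have "AE x in lborel. \<forall>\<^sub>F n in sequentially. x \<notin> A n"
  proof (rule AE_eventually_notin[OF A(1,2)])
    have "0 < (1 - \<epsilon>) * \<delta>" using \<epsilon> \<open>0 < \<delta>\<close> by simp
    then show "summable ?c"
      using \<epsilon> by (intro summable_add summable_mult summable_geometric) (auto simp: two_powr_minus_less_1)
  qed (use \<open>0 < C\<close> in auto)
  then show ?thesis
    by eventually_elim (auto elim!: eventually_mono intro: A(3))
qed

subsection \<open>The return time exponent\<close>

text \<open>The passage from dyadic radii to all radii: for 2^(-n-1) < \<open>r\<close> \<le> 2^(-n)
  the upper bound is taken at \<open>Suc n\<close> and the lower bound at \<open>n\<close>. The set
  \<open>E\<close> is kept as a parameter because the almost sure bounds can be combined for
  countably many \<epsilon> only.\<close>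

lemma return_time_exponent:
  fixes C :: real
  assumes C: "0 < C"
    and up: "\<And>\<epsilon>. 0 < \<epsilon> \<Longrightarrow> \<epsilon> < 1 \<Longrightarrow> \<epsilon> \<in> E \<Longrightarrow> \<forall>\<^sub>F n in sequentially.
      \<exists>j\<ge>1. real j \<le> 2 * 2 powr (real n * (1 + \<epsilon>)) \<and> \<bar>(iet_map T ^^ j) x - x\<bar> < 2 powr (- real n)"
    and low: "\<And>\<epsilon>. 0 < \<epsilon> \<Longrightarrow> \<epsilon> < 1 \<Longrightarrow> \<epsilon> \<in> E \<Longrightarrow> \<forall>\<^sub>F n in sequentially.
      \<forall>i\<ge>1. \<bar>(iet_map T ^^ i) x - x\<bar> < 2 powr (- real n) \<longrightarrow> 2 powr (real n * (1 - \<epsilon>)) \<le> C * real i"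
    and E: "\<And>e. 0 < e \<Longrightarrow> \<exists>\<epsilon>\<in>E. 0 < \<epsilon> \<and> \<epsilon> < 1 \<and> \<epsilon> < e"
  shows "((\<lambda>r. ln (real (return_time T r x)) / (- ln r)) \<longlongrightarrow> 1) (at_right 0)"
proof (rule tendstoI)
  fix e :: real assume "0 < e"
  then obtain \<epsilon> where \<epsilon>: "\<epsilon> \<in> E" "0 < \<epsilon>" "\<epsilon> < 1" "\<epsilon> < e / 2" using E[of "e / 2"] by auto
  obtain n0 where n0: "\<And>n. n \<ge> n0 \<Longrightarrow> \<exists>j\<ge>1. real j \<le> 2 * 2 powr (real n * (1 + \<epsilon>)) \<and> \<bar>(iet_map T ^^ j) x - x\<bar> < 2 powr (- real n)"
    "\<And>n i. n \<ge> n0 \<Longrightarrow> 1 \<le> i \<Longrightarrow> \<bar>(iet_map T ^^ i) x - x\<bar> < 2 powr (- real n) \<Longrightarrow> 2 powr (real n * (1 - \<epsilon>)) \<le> C * real i"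
    using eventually_conj[OF up low, OF \<epsilon>(2,3,1) \<epsilon>(2,3,1)] by (auto simp: eventually_sequentially)
  define c where "c = \<bar>ln C\<bar> / ln 2"
  have c: "0 \<le> c" "ln C \<le> c * ln 2" by (auto simp: c_def)
  \<comment> \<open>With L = -log2 \<open>r\<close>, the term \<open>real n0 + 1\<close> puts L
    beyond the threshold \<open>n0\<close>, and \<open>(3 + c) * (2 / e)\<close> makes all additive
    errors, including the one from \<open>C\<close>, smaller than \<open>e / 2 * L\<close>. The
    other half of the error is paid by \<open>\<epsilon> < e / 2\<close>.\<close>
  have "\<forall>\<^sub>F r in at_right 0. - ln r > (real n0 + 1 + (3 + c) * (2 / e)) * ln 2"
    using filterlim_uminus_at_bot[THEN iffD1, OF ln_at_0] unfolding filterlim_at_top_dense by blast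
  moreover have "\<forall>\<^sub>F r in at_right (0::real). 0 < r" by (simp add: eventually_at_right_less)
  ultimately show "\<forall>\<^sub>F r in at_right 0. dist (ln (real (return_time T r x)) / (- ln r)) 1 < e"
  proof eventually_elim
    fix r :: real assume r: "(real n0 + 1 + (3 + c) * (2 / e)) * ln 2 < - ln r" "0 < r"
    define L where "L = - ln r / ln 2"
    have L: "- ln r = L * ln 2" by (simp add: L_def)
    have Lb: "real n0 + 1 + (3 + c) * (2 / e) < L" using r(1) unfolding L by simp
    have q: "0 \<le> (3 + c) * (2 / e)" using c \<open>0 < e\<close> by simp
    have L1: "1 < L" "real n0 \<le> L" "(3 + c) * (2 / e) < L" using Lb q by linarith+
    define n where "n = nat \<lfloor>L\<rfloor>"
    have n: "real n \<le> L" "L < real n + 1" using L1 unfolding n_def by linarith+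
    have "n0 \<le> n" using L1(2) unfolding n_def by linarith
    have r_eq: "r = 2 powr (- L)" using r(2) by (simp add: powr_def L[symmetric])
    have rn: "2 powr (- real (Suc n)) < r" "r \<le> 2 powr (- real n)" using n unfolding r_eq by auto
    obtain j where j: "1 \<le> j" "real j \<le> 2 * 2 powr (real (Suc n) * (1 + \<epsilon>))" "\<bar>(iet_map T ^^ j) x - x\<bar> < 2 powr (- real (Suc n))"
      using n0(1)[of "Suc n"] \<open>n0 \<le> n\<close> by auto
    have jr: "1 \<le> j \<and> \<bar>(iet_map T ^^ j) x - x\<bar> < r" using j rn by linarith
    define t where "t = return_time T r x"
    have t: "1 \<le> t" "\<bar>(iet_map T ^^ t) x - x\<bar> < r" "t \<le> j"
      using LeastI[of "\<lambda>j. 1 \<le> j \<and> \<bar>(iet_map T ^^ j) x - x\<bar> < r", OF jr] Least_le[of "\<lambda>j. 1 \<le> j \<and> \<bar>(iet_map T ^^ j) x - x\<bar> < r", OF jr]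
      by (auto simp: t_def return_time_def)
    have "real t \<le> 2 powr (1 + real (Suc n) * (1 + \<epsilon>))" using t(3) j(2) by (simp add: powr_add)
    then have "ln (real t) \<le> ln (2 powr (1 + real (Suc n) * (1 + \<epsilon>)))" using t(1) by (subst ln_le_cancel_iff) auto
    then have u: "ln (real t) \<le> (1 + (real n + 1) * (1 + \<epsilon>)) * ln 2" by (simp add: ln_powr add.commute)
    have "(real n + 1) * (1 + \<epsilon>) \<le> (L + 1) * (1 + \<epsilon>)" using n \<epsilon> by (intro mult_right_mono) auto
    then have "(1 + (real n + 1) * (1 + \<epsilon>)) * ln 2 \<le> (1 + (L + 1) * (1 + \<epsilon>)) * ln 2" by (intro mult_right_mono) auto
    with u have u: "ln (real t) \<le> (1 + (L + 1) * (1 + \<epsilon>)) * ln 2" by linarith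
    have "2 powr (real n * (1 - \<epsilon>)) \<le> C * real t" using n0(2)[of n t] \<open>n0 \<le> n\<close> t rn by linarith
    then have "ln (2 powr (real n * (1 - \<epsilon>))) \<le> ln (C * real t)" using t(1) C by (subst ln_le_cancel_iff) auto
    then have "real n * (1 - \<epsilon>) * ln 2 \<le> ln C + ln (real t)" using t(1) C by (simp add: ln_powr ln_mult)
    moreover have "(L - 1) * (1 - \<epsilon>) \<le> real n * (1 - \<epsilon>)" using n \<epsilon> by (intro mult_right_mono) auto
    then have "(L - 1) * (1 - \<epsilon>) * ln 2 \<le> real n * (1 - \<epsilon>) * ln 2" by (rule mult_right_mono) simp
    ultimately have l: "((L - 1) * (1 - \<epsilon>) - c) * ln 2 \<le> ln (real t)" using c(2) by (simp add: left_diff_distrib) 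
    have pos: "0 < L * ln 2" using L1 by simp
    have ce: "3 + c < e / 2 * L" using L1(3) \<open>0 < e\<close> by (simp add: field_simps)
    have eL: "\<epsilon> * L \<le> e / 2 * L" using \<epsilon>(4) L1 by (intro mult_right_mono) auto
    have "1 + (L + 1) * (1 + \<epsilon>) < (1 + e) * L"
      using ce eL \<epsilon> c by (simp add: algebra_simps)
    then have "(1 + (L + 1) * (1 + \<epsilon>)) * ln 2 < (1 + e) * L * ln 2" by (rule mult_strict_right_mono) simp
    with u have "ln (real t) < (1 + e) * (L * ln 2)" unfolding mult.assoc by linarith
    then have 1: "ln (real t) / (- ln r) < 1 + e" unfolding L using pos_divide_less_eq[OF pos] by blast
    have "(1 - e) * L < (L - 1) * (1 - \<epsilon>) - c"
      using ce eL \<epsilon> c by (simp add: algebra_simps)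
    then have "(1 - e) * L * ln 2 < ((L - 1) * (1 - \<epsilon>) - c) * ln 2" by (rule mult_strict_right_mono) simp
    with l have "(1 - e) * (L * ln 2) < ln (real t)" unfolding mult.assoc by linarith
    then have 2: "1 - e < ln (real t) / (- ln r)" unfolding L using pos_less_divide_eq[OF pos] by blast
    show "dist (ln (real (return_time T r x)) / (- ln r)) 1 < e"
      using 1 2 unfolding t_def dist_real_def by linarith
  qed
qed

lemma condition_R_if_thin_towers:
  assumes T: "is_iet T" and tot: "total_len T = 1" and thin: "thin_towers T C \<delta>" and C: "0 < C" and \<delta>: "0 < \<delta>"
  shows "condition_R T"
proof -
  define E where "E = range (\<lambda>m::nat. 1 / (real m + 2))"
  have cE: "countable E" by (simp add: E_def)
  have E01: "0 < \<epsilon>" "\<epsilon> < 1" if "\<epsilon> \<in> E" for \<epsilon> using that by (auto simp: E_def field_simps)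
  have E: "\<exists>\<epsilon>\<in>E. 0 < \<epsilon> \<and> \<epsilon> < 1 \<and> \<epsilon> < e" if "0 < e" for e
  proof -
    obtain m :: nat where "1 / e < real m" using reals_Archimedean2 by blast
    then have "1 / (real m + 2) < e" using that by (simp add: field_simps)
    then show ?thesis using E01 by (intro bexI[of _ "1 / (real m + 2)"]) (auto simp: E_def)
  qed
  have "AE x in lborel. \<forall>\<epsilon>\<in>E. 0 \<le> x \<and> x < 1 \<longrightarrow> (\<forall>\<^sub>F n in sequentially.
    \<exists>j\<ge>1. real j \<le> 2 * 2 powr (real n * (1 + \<epsilon>)) \<and> \<bar>(iet_map T ^^ j) x - x\<bar> < 2 powr (- real n))"
    using AE_return_time_upper[OF T tot] E01 by (subst AE_ball_countable[OF cE]) blast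
  moreover have "AE x in lborel. \<forall>\<epsilon>\<in>E. 0 \<le> x \<and> x < 1 \<longrightarrow> (\<forall>\<^sub>F n in sequentially.
    \<forall>i\<ge>1. \<bar>(iet_map T ^^ i) x - x\<bar> < 2 powr (- real n) \<longrightarrow> 2 powr (real n * (1 - \<epsilon>)) \<le> C * real i)"
    using AE_return_time_lower[OF T tot thin C \<delta>] E01 by (subst AE_ball_countable[OF cE]) blast
  ultimately have "AE x in lborel. x \<in> {0..<total_len T} \<longrightarrow>
        ((\<lambda>r. ln (real (return_time T r x)) / (- ln r)) \<longlongrightarrow> 1) (at_right 0)"
  proof eventually_elim
    case (elim x)
    show ?case
    proof (rule impI, rule return_time_exponent[OF C _ _ E])
      fix \<epsilon> :: real assume "x \<in> {0..<total_len T}" "\<epsilon> \<in> E"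
      then have "\<epsilon> \<in> E" "0 \<le> x \<and> x < 1" by (auto simp: tot)
      with elim show "\<forall>\<^sub>F n in sequentially. \<exists>j\<ge>1. real j \<le> 2 * 2 powr (real n * (1 + \<epsilon>)) \<and> \<bar>(iet_map T ^^ j) x - x\<bar> < 2 powr (- real n)"
        "\<forall>\<^sub>F n in sequentially. \<forall>i\<ge>1. \<bar>(iet_map T ^^ i) x - x\<bar> < 2 powr (- real n) \<longrightarrow> 2 powr (real n * (1 - \<epsilon>)) \<le> C * real i"
        by blast+
    qed
  qed
  then show ?thesis unfolding condition_R_def by (rule AE_completion)
qed

section \<open>A path in the Rauzy diagram\<close>

subsection \<open>Cones of length vectors\<close>

text \<open>The inverse, on length vectors, of a Rauzy--Veech step with winner \<open>w\<close> and
  loser \<open>x\<close>.\<close>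

definition shear :: "'n \<Rightarrow> 'n \<Rightarrow> real^'n \<Rightarrow> real^'n::finite" where
  "shear w x v = (\<chi> i. if i = w then v $ w + v $ x else v $ i)"

lemma shear_nth [simp]: "shear w x v $ i = (if i = w then v $ w + v $ x else v $ i)"
  by (simp add: shear_def)

text \<open>Growth of every coordinate on the nonnegative cone keeps preimages of bounded vectors
  bounded, which gives compactness below; injectivity makes the backward orbit of a vector
  unique.\<close>

definition cone_map :: "(real^'n \<Rightarrow> real^'n::finite) \<Rightarrow> bool" where
  "cone_map f \<longleftrightarrow> linear f \<and> inj f \<and>
     (\<forall>v. (\<forall>i. 0 \<le> v $ i) \<longrightarrow> (\<forall>i. v $ i \<le> f v $ i))"

lemma cone_map_shear: "w \<noteq> x \<Longrightarrow> cone_map (shear w x)"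
  unfolding cone_map_def
proof (intro conjI)
  assume "w \<noteq> x"
  show "linear (shear w x)" by (rule linearI) (auto simp: vec_eq_iff algebra_simps)
  show "inj (shear w x)"
  proof (rule injI)
    fix v v' assume *: "shear w x v = shear w x v'"
    have "v $ x = v' $ x" using arg_cong[OF *, of "\<lambda>v. v $ x"] \<open>w \<noteq> x\<close> by simp
    then have "v $ i = v' $ i" for i
      using arg_cong[OF *, of "\<lambda>v. v $ i"] by (simp split: if_splits)
    then show "v = v'" by (simp add: vec_eq_iff)
  qed
qed auto

lemma cone_map_id: "cone_map id"
  by (simp add: cone_map_def linear_id)

lemma cone_map_compose: "cone_map f \<Longrightarrow> cone_map g \<Longrightarrow> cone_map (f \<circ> g)"
  unfolding cone_map_def o_def
  by (auto intro: linear_compose[unfolded o_def] inj_compose[unfolded o_def]) (meson order_trans)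

lemma cone_map_funpow: "cone_map f \<Longrightarrow> cone_map (f ^^ n)"
  by (induction n) (simp_all only: funpow.simps cone_map_compose cone_map_id)

lemma cone_map_pos:
  assumes "cone_map f" "\<And>i. 0 < v $ i"
  shows "0 < f v $ i"
  using assms unfolding cone_map_def by (meson less_imp_le less_le_trans)

lemma cone_map_nonneg:
  assumes "cone_map f" "\<And>i. 0 \<le> v $ i"
  shows "0 \<le> f v $ i"
  using assms unfolding cone_map_def by (meson order_trans)

text \<open>\<open>F k\<close> consists of the unit-sum vectors that can be pulled back
  \<open>k\<close> times within the unit box. These sets are compact, nonempty and decreasing. A
  common point has a preimage at every depth, and injectivity makes these preimages fit
  together.\<close>

lemma cone_map_sequence:
  fixes f :: "nat \<Rightarrow> real^'n::finite \<Rightarrow> real^'n"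
  assumes f: "\<And>k. cone_map (f k)"
  obtains v where "\<And>k. v k = f k (v (Suc k))" "\<And>k i. 0 \<le> v k $ i" "(\<Sum>i\<in>UNIV. v 0 $ i) = 1"
proof -
  define P where "P = rec_nat id (\<lambda>k Q. Q \<circ> f k)"
  have P0: "P 0 = id" and PS: "P (Suc k) = P k \<circ> f k" for k by (simp_all add: P_def)
  have P: "cone_map (P k)" for k
    by (induction k) (simp_all only: P0 PS cone_map_id cone_map_compose f)
  define B :: "(real^'n) set" where "B = cbox 0 1"
  have B: "v \<in> B \<longleftrightarrow> (\<forall>i. 0 \<le> v $ i \<and> v $ i \<le> 1)" for v by (simp add: B_def mem_box_cart)
  define F where "F k = P k ` B \<inter> {v. (\<Sum>i\<in>UNIV. v $ i) = 1}" for k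
  have "\<Inter>(range F) \<noteq> {}"
  proof (rule compact_nest)
    fix k
    have "continuous_on B (P k)" using P[of k] by (simp add: cone_map_def linear_continuous_on linear_conv_bounded_linear)
    then have "compact (P k ` B)" by (intro compact_continuous_image) (auto simp: B_def)
    moreover have "closed {v::real^'n. (\<Sum>i\<in>UNIV. v $ i) = 1}"
      by (intro closed_Collect_eq continuous_intros)
    ultimately show "compact (F k)" unfolding F_def by (rule compact_Int_closed)
    have lin: "linear (P k)" using P[of k] by (simp add: cone_map_def)
    \<comment> \<open>Nonemptiness: growth gives \<open>1 \<le> ?s\<close>, so the all-ones vector
      divided by \<open>?s\<close> stays in the box, and its image has sum 1.\<close>
    let ?s = "\<Sum>i\<in>UNIV. P k 1 $ i"
    have ge: "1 \<le> P k 1 $ i" for i using P[of k] unfolding cone_map_def by (metis one_index zero_le_one)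
    have "of_nat CARD('n) \<le> ?s" using sum_mono[of UNIV "\<lambda>_. 1" "\<lambda>i. P k 1 $ i"] ge by simp
    moreover have "(1::real) \<le> of_nat CARD('n)" by (simp add: Suc_le_eq)
    ultimately have s: "1 \<le> ?s" by linarith
    have "(1 / ?s) *\<^sub>R 1 \<in> B" using s by (auto simp: B)
    moreover have "(\<Sum>i\<in>UNIV. P k ((1 / ?s) *\<^sub>R 1) $ i) = 1"
      using s by (simp add: linear_scale[OF lin] flip: sum_divide_distrib)
    ultimately have "P k ((1 / ?s) *\<^sub>R 1) \<in> F k" unfolding F_def by blast
    then show "F k \<noteq> {}" by blast
  next
    \<comment> \<open>Monotonicity: the entries of \<open>v = P k (f k y)\<close> are at most 1
      because they sum to 1, and by growth they dominate those of \<open>f k y\<close>, which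
      therefore lies in the box.\<close>
    have "F (Suc k) \<subseteq> F k" for k
    proof
      fix v assume v: "v \<in> F (Suc k)"
      then obtain y where y: "y \<in> B" "v = P k (f k y)" and s: "(\<Sum>i\<in>UNIV. v $ i) = 1" by (auto simp: F_def PS)
      have nn: "0 \<le> f k y $ i" for i using y by (intro cone_map_nonneg[OF f]) (simp add: B)
      have "f k y $ i \<le> v $ i" for i using nn P[of k] unfolding y cone_map_def by blast
      moreover have "v $ i \<le> 1" for i
        using s member_le_sum[of i UNIV "\<lambda>i. v $ i"] nn calculation by (auto intro: order_trans)
      ultimately have "f k y \<in> B" unfolding B using nn by (meson order_trans)
      then show "v \<in> F k" using y s by (auto simp: F_def)
    qed
    then show "m \<le> n \<Longrightarrow> F n \<subseteq> F m" for m n by (rule lift_Suc_antimono_le)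
  qed
  then obtain v0 where v0: "\<And>k. v0 \<in> F k" by blast
  then have "\<forall>k. \<exists>y\<in>B. v0 = P k y" by (auto simp: F_def)
  then obtain v where v: "\<And>k. v k \<in> B" "\<And>k. v0 = P k (v k)" by metis
  have "P k (v k) = P k (f k (v (Suc k)))" for k using v(2)[of k] v(2)[of "Suc k"] by (simp add: PS)
  then have "v k = f k (v (Suc k))" for k using P[of k] unfolding cone_map_def by (metis injD)
  moreover have "(\<Sum>i\<in>UNIV. v 0 $ i) = 1" using v0[of 0] v(2)[of 0] by (simp add: F_def P0)
  ultimately show ?thesis using that v(1) unfolding B by blast
qed

subsection \<open>Arrows of the Rauzy diagram\<close>

definition quad :: "nat \<Rightarrow> nat \<Rightarrow> nat \<Rightarrow> nat \<Rightarrow> 4 \<Rightarrow> nat" where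
  "quad a b c d = (\<lambda>i. if i = 1 then a else if i = 2 then b else if i = 3 then c else d)"

lemma quad_simps [simp]: "quad a b c d 1 = a" "quad a b c d 2 = b" "quad a b c d 3 = c" "quad a b c d 4 = d"
  by (simp_all add: quad_def)

definition iet_of :: "(4 \<Rightarrow> nat) \<times> (4 \<Rightarrow> nat) \<Rightarrow> real^4 \<Rightarrow> 4 iet" where
  "iet_of \<pi> v = \<lparr> pi_t = fst \<pi>, pi_b = snd \<pi>, len = ($) v \<rparr>"

text \<open>The flag \<open>tt\<close> is the type. The length vector 0 is only a placeholder: the
  last letters depend on the permutations alone.\<close>

definition arrow :: "bool \<Rightarrow> 4 \<Rightarrow> 4 \<Rightarrow> (4 \<Rightarrow> nat) \<times> (4 \<Rightarrow> nat) \<Rightarrow> (4 \<Rightarrow> nat) \<times> (4 \<Rightarrow> nat) \<Rightarrow> bool" where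
  "arrow tt w x \<pi> \<pi>' \<longleftrightarrow> w \<noteq> x \<and>
     bij_betw (fst \<pi>') UNIV {1..4} \<and> bij_betw (snd \<pi>') UNIV {1..4} \<and>
     (if tt then last_t (iet_of \<pi> 0) = w \<and> last_b (iet_of \<pi> 0) = x \<and> \<pi>' = (fst \<pi>, move_after (snd \<pi>) x w)
      else last_t (iet_of \<pi> 0) = x \<and> last_b (iet_of \<pi> 0) = w \<and> \<pi>' = (move_after (fst \<pi>) x w, snd \<pi>))"

text \<open>Prescribing the lengths \<open>v\<close> after the step makes the type automatic: before
  it the loser has length \<open>v $ x\<close> and the winner the larger
  \<open>v $ w + v $ x\<close>.\<close>

lemma arrow_step:
  assumes ar: "arrow tt w x \<pi> \<pi>'" and v: "\<And>i. 0 < v $ i"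
  defines "S \<equiv> iet_of \<pi> (shear w x v)"
  shows "top_type S = tt" "winner S = w" "loser S = x" "rv_step S = iet_of \<pi>' v" "is_iet (rv_step S)"
    "len S (loser S) < len S (winner S)"
proof -
  have last: "last_t S = last_t (iet_of \<pi> 0)" "last_b S = last_b (iet_of \<pi> 0)"
    by (simp_all add: S_def iet_of_def last_t_def last_b_def)
  have neq: "w \<noteq> x" using ar by (simp add: arrow_def)
  have len: "len S = ($) (shear w x v)" by (simp add: S_def iet_of_def)
  show tt: "top_type S = tt"
    using ar v[of w] neq by (cases tt) (auto simp: top_type_def last len arrow_def)
  show w: "winner S = w" and x: "loser S = x"
    using ar by (auto simp: winner_def loser_def tt last arrow_def split: if_splits)
  have "(\<lambda>i. shear w x v $ i)(w := shear w x v $ w - shear w x v $ x) = ($) v"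
    using neq by (auto simp: fun_eq_iff)
  then show step: "rv_step S = iet_of \<pi>' v"
    using ar unfolding rv_step_def w x tt last
    by (auto simp: arrow_def iet_of_def S_def split: if_splits)
  show "is_iet (rv_step S)"
    using ar v unfolding step by (auto simp: is_iet_def iet_of_def arrow_def)
  show "len S (loser S) < len S (winner S)" using v[of w] neq by (simp add: w x len)
qed

text \<open>The letters \<open>A, B, C, D\<close> are \<open>1, 2, 3, 4\<close>. The vertices are, in this order, \<open>ABCD/DCBA\<close>,
  \<open>ABCD/DACB\<close>, \<open>ABDC/DACB\<close>, \<open>ABCD/DBAC\<close>, \<open>ADBC/DCBA\<close> and \<open>ACDB/DCBA\<close>.\<close>

abbreviation "vertex_c \<equiv> (quad 1 2 3 4, quad 4 3 2 1)"
abbreviation "vertex_v \<equiv> (quad 1 2 3 4, quad 2 4 3 1)"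
abbreviation "vertex_v1 \<equiv> (quad 1 2 4 3, quad 2 4 3 1)"
abbreviation "vertex_v2 \<equiv> (quad 1 2 3 4, quad 3 2 4 1)"
abbreviation "vertex_u1 \<equiv> (quad 1 3 4 2, quad 4 3 2 1)"
abbreviation "vertex_u2 \<equiv> (quad 1 4 2 3, quad 4 3 2 1)"

lemma interval_1_4: "{1..4::nat} = {1, 2, 3, 4}" by auto

lemma bij_betw_quad: "{a, b, c, d} = {1, 2, 3, 4} \<Longrightarrow> bij_betw (quad a b c d) UNIV {1..4}"
  unfolding bij_betw_def
proof
  assume *: "{a, b, c, d} = {1, 2, 3, 4}"
  have r: "range (quad a b c d) = {a, b, c, d}" by (auto simp: UNIV_4)
  then show "range (quad a b c d) = {1..4}" using * interval_1_4 by simp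
  then have "card (range (quad a b c d)) = card (UNIV :: 4 set)" by simp
  then show "inj (quad a b c d)" by (simp add: eq_card_imp_inj_on)
qed

lemma bij_quads:
  "bij_betw (quad 1 2 3 4) UNIV {1..4}" "bij_betw (quad 4 3 2 1) UNIV {1..4}"
  "bij_betw (quad 2 4 3 1) UNIV {1..4}" "bij_betw (quad 1 2 4 3) UNIV {1..4}"
  "bij_betw (quad 3 2 4 1) UNIV {1..4}" "bij_betw (quad 1 3 4 2) UNIV {1..4}"
  "bij_betw (quad 1 4 2 3) UNIV {1..4}"
  by (rule bij_betw_quad; auto)+

lemma the_bij_eq_iff:
  assumes "bij_betw p (UNIV :: 'a set) B" "b \<in> B"
  shows "(THE a. p a = b) = w \<longleftrightarrow> p w = b"
proof -
  obtain a where a: "p a = b" using assms by (auto simp: bij_betw_def)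
  have "a' = a" if "p a' = b" for a' using assms a that by (metis bij_betw_def injD)
  then show ?thesis using a by (metis (mono_tags, lifting) the_equality)
qed

lemma last_iet_of:
  "bij_betw p UNIV {1..4} \<Longrightarrow> last_t (iet_of (p, q) v) = w \<longleftrightarrow> p w = 4"
  "bij_betw q UNIV {1..4} \<Longrightarrow> last_b (iet_of (p, q) v) = w \<longleftrightarrow> q w = 4"
  unfolding last_t_def last_b_def iet_of_def by (simp_all add: the_bij_eq_iff)

text \<open>In order: D beats A on the way to \<open>vertex_v\<close>; the three arrows of the loop
  at \<open>vertex_v\<close>; two wins of D that lead back to \<open>vertex_c\<close>; the cycle at
  \<open>vertex_c\<close> in which A beats D, C and B.\<close>

lemma arrows:
  "arrow True 4 1 vertex_c vertex_v"
  "arrow False 2 4 vertex_v vertex_v1"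
  "arrow True 3 2 vertex_v1 vertex_v1"
  "arrow False 2 3 vertex_v1 vertex_v"
  "arrow True 4 2 vertex_v vertex_v2"
  "arrow True 4 3 vertex_v2 vertex_c"
  "arrow False 1 4 vertex_c vertex_u1"
  "arrow False 1 3 vertex_u1 vertex_u2"
  "arrow False 1 2 vertex_u2 vertex_c"
  unfolding arrow_def fst_conv snd_conv if_True if_False Pair_inject
  by (intro conjI; (rule bij_quads | subst last_iet_of, rule bij_quads | simp); simp add: fun_eq_iff forall_4 move_after_def)+

subsection \<open>Stages of the algorithm\<close>

text \<open>\<open>h\<close> is both the vector of row sums of the matrix \<open>Q(0,n)\<close> and the vector of tower heights;
  \<open>K\<close> bounds from below the levels of the left ends of \<open>T\<close>, as needed for \<open>keaneI\<close>.\<close>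

definition at_stage :: "4 iet \<Rightarrow> nat \<Rightarrow> 4 iet \<Rightarrow> (4 \<Rightarrow> nat) \<Rightarrow> (4 \<Rightarrow> nat) \<Rightarrow> bool" where
  "at_stage T n S h K \<longleftrightarrow> rv_iter T n = S \<and> (\<exists>k u. towers T S h k u \<and> (\<forall>\<gamma>. K \<gamma> \<le> k \<gamma>)) \<and>
     (\<forall>i j. 0 \<le> rv_matrix T 0 n $ i $ j) \<and> (\<forall>i. (\<Sum>j\<in>UNIV. rv_matrix T 0 n $ i $ j) = real (h i))"

lemma at_stage_init: "is_iet T \<Longrightarrow> at_stage T 0 T (\<lambda>_. 1) (\<lambda>_. 0)"
  using towers_init[of T] by (auto simp: at_stage_def rv_iter_def mat_def intro!: exI)

lemma step_matrix_mult:
  assumes "loser S \<noteq> winner S"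
  shows "(step_matrix S ** Q) $ i $ j = Q $ i $ j + (if i = loser S then Q $ winner S $ j else 0)"
proof -
  have "(step_matrix S ** Q) $ i $ j =
     (\<Sum>k\<in>UNIV. (if i = k then Q $ k $ j else 0) + (if k = winner S then (if i = loser S then Q $ k $ j else 0) else 0))"
    unfolding matrix_matrix_mult_def step_matrix_def by (auto simp: mat_def algebra_simps intro!: sum.cong)
  also have "\<dots> = Q $ i $ j + (if i = loser S then Q $ winner S $ j else 0)"
    by (simp add: sum.distrib)
  finally show ?thesis .
qed

text \<open>Row sums and heights obey the same rule, adding the winner's value to the loser's. A
  bottom step lifts the marked level of the loser by \<open>h w\<close>; only \<open>0 < h w\<close>
  is recorded, so \<open>K\<close> grows by one.\<close>

lemma at_stage_arrow:
  assumes at: "at_stage T n (iet_of \<pi> (shear w x v)) h K"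
    and ar: "arrow tt w x \<pi> \<pi>'" and v: "\<And>i. 0 < v $ i"
  shows "at_stage T (Suc n) (iet_of \<pi>' v) (h(x := h x + h w)) (if tt then K else K(x := Suc (K x)))"
proof -
  let ?S = "iet_of \<pi> (shear w x v)"
  note s = arrow_step[OF ar v]
  have neq: "x \<noteq> w" using ar unfolding arrow_def by blast
  obtain k u where tw: "towers T ?S h k u" and K: "\<And>\<gamma>. K \<gamma> \<le> k \<gamma>" and it: "rv_iter T n = ?S"
    and nn: "\<And>i j. 0 \<le> rv_matrix T 0 n $ i $ j" and row: "\<And>i. (\<Sum>j\<in>UNIV. rv_matrix T 0 n $ i $ j) = real (h i)"
    using at by (auto simp: at_stage_def)
  obtain u' where tw': "towers T (iet_of \<pi>' v) (h(x := h x + h w)) (if tt then k else k(x := h w + k x)) u'"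
    using towers_step[OF tw] s by auto
  have hw: "0 < h w" using tw by (auto simp: towers_def dest: spec[of _ w])
  have Q: "rv_matrix T 0 (Suc n) $ i $ j = rv_matrix T 0 n $ i $ j + (if i = x then rv_matrix T 0 n $ w $ j else 0)" for i j
    using step_matrix_mult[of ?S "rv_matrix T 0 n"] neq s by (simp add: it)
  show ?thesis
    unfolding at_stage_def
  proof (intro conjI allI)
    show "rv_iter T (Suc n) = iet_of \<pi>' v" using it s by (simp add: rv_iter_def)
    show "\<exists>k u. towers T (iet_of \<pi>' v) (h(x := h x + h w)) k u \<and> (\<forall>\<gamma>. (if tt then K else K(x := Suc (K x))) \<gamma> \<le> k \<gamma>)"
    proof (intro exI conjI, rule tw', rule allI)
      fix \<gamma> show "(if tt then K else K(x := Suc (K x))) \<gamma> \<le> (if tt then k else k(x := h w + k x)) \<gamma>"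
        using hw K[of x] K[of \<gamma>] by auto
    qed
    show "0 \<le> rv_matrix T 0 (Suc n) $ i $ j" for i j unfolding Q using nn by simp
    show "(\<Sum>j\<in>UNIV. rv_matrix T 0 (Suc n) $ i $ j) = real ((h(x := h x + h w)) i)" for i
      unfolding Q using row by (simp add: sum.distrib)
  qed
qed

lemma at_stage_mono: "at_stage T n S h K \<Longrightarrow> (\<And>\<gamma>. K' \<gamma> \<le> K \<gamma>) \<Longrightarrow> at_stage T n S h K'"
  unfolding at_stage_def by (meson le_trans)

definition raise :: "4 \<Rightarrow> 4 \<Rightarrow> (4 \<Rightarrow> nat) \<Rightarrow> 4 \<Rightarrow> nat" where
  "raise x w h = h(x := h x + h w)"

text \<open>The maps on length vectors go against the arrows of the path, those on heights along them.\<close>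

definition loop :: "real^4 \<Rightarrow> real^4" where "loop = shear 2 4 \<circ> shear 3 2 \<circ> shear 2 3"
definition streak :: "real^4 \<Rightarrow> real^4" where "streak = shear 1 4 \<circ> shear 1 3 \<circ> shear 1 2"
definition merge :: "real^4 \<Rightarrow> real^4" where "merge = shear 4 2 \<circ> shear 4 3"
definition block :: "nat \<Rightarrow> nat \<Rightarrow> real^4 \<Rightarrow> real^4" where
  "block m N = shear 4 1 \<circ> (loop ^^ m) \<circ> merge \<circ> (streak ^^ N)"

definition hloop :: "(4 \<Rightarrow> nat) \<Rightarrow> 4 \<Rightarrow> nat" where "hloop = raise 3 2 \<circ> raise 2 3 \<circ> raise 4 2"
definition hstreak :: "(4 \<Rightarrow> nat) \<Rightarrow> 4 \<Rightarrow> nat" where "hstreak = raise 2 1 \<circ> raise 3 1 \<circ> raise 4 1"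
definition hmerge :: "(4 \<Rightarrow> nat) \<Rightarrow> 4 \<Rightarrow> nat" where "hmerge = raise 3 4 \<circ> raise 2 4"
definition hblock :: "nat \<Rightarrow> nat \<Rightarrow> (4 \<Rightarrow> nat) \<Rightarrow> 4 \<Rightarrow> nat" where
  "hblock m N = (hstreak ^^ N) \<circ> hmerge \<circ> (hloop ^^ m) \<circ> raise 1 4"

lemma cone_maps: "cone_map loop" "cone_map streak" "cone_map merge" "cone_map (block m N)"
proof -
  show *: "cone_map loop" "cone_map streak" "cone_map merge"
    unfolding loop_def streak_def merge_def by (intro cone_map_compose cone_map_shear; simp)+
  show "cone_map (block m N)"
    unfolding block_def by (intro cone_map_compose cone_map_funpow cone_map_shear *) simp
qed

lemmas cone_pos = cone_map_pos[OF cone_maps(1)] cone_map_pos[OF cone_maps(2)] cone_map_pos[OF cone_maps(3)]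
  cone_map_pos[OF cone_map_funpow[OF cone_maps(1)]] cone_map_pos[OF cone_map_funpow[OF cone_maps(2)]]

lemma shear_pos: "(\<And>i. 0 < v $ i) \<Longrightarrow> 0 < shear w x v $ i"
  by (simp add: add_pos_pos)

section \<open>Stages along a block\<close>

lemma at_stage_loop:
  assumes "at_stage T n (iet_of vertex_v (loop v)) h K" and v: "\<And>i. 0 < v $ i"
  shows "at_stage T (n + 3) (iet_of vertex_v v) (hloop h) K"
proof -
  have v3: "\<And>i. 0 < shear 2 3 v $ i" by (rule shear_pos[OF v])
  have v4: "\<And>i. 0 < shear 3 2 (shear 2 3 v) $ i" by (rule shear_pos[OF v3])
  note 0 = assms(1)[unfolded loop_def o_apply]
  note 1 = at_stage_arrow[OF 0 arrows(2) v4, folded raise_def, unfolded if_False]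
  note 2 = at_stage_arrow[OF 1 arrows(3) v3, folded raise_def, unfolded if_True]
  note 3 = at_stage_arrow[OF 2 arrows(4) v, folded raise_def, unfolded if_False]
  \<comment> \<open>The gain in the marks of C and D is given up: B gains nothing here, and the
    streaks raise all three marks uniformly.\<close>
  have "at_stage T (n + 3) (iet_of vertex_v v) (hloop h) (K(4 := Suc (K 4), 3 := Suc ((K(4 := Suc (K 4))) 3)))"
    using 3 by (simp add: hloop_def numeral_3_eq_3)
  then show ?thesis by (rule at_stage_mono) auto
qed

lemma at_stage_loops:
  assumes "at_stage T n (iet_of vertex_v ((loop ^^ i) v)) h K" and v: "\<And>i. 0 < v $ i"
  shows "at_stage T (n + 3 * i) (iet_of vertex_v v) ((hloop ^^ i) h) K"
  using assms(1)
proof (induction i arbitrary: n h)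
  case (Suc i)
  have "at_stage T (n + 3) (iet_of vertex_v ((loop ^^ i) v)) (hloop h) K"
    using Suc.prems cone_pos(4)[OF v] by (intro at_stage_loop) auto
  from Suc.IH[OF this] show ?case by (simp add: funpow_swap1 algebra_simps)
qed simp

text \<open>All three arrows are of bottom type and their losers are D, C and B, so each of these
  marks rises. This is the source of the Keane property; A comes first in the top row and needs no
  bound.\<close>

lemma at_stage_streak:
  assumes "at_stage T n (iet_of vertex_c (streak v)) h (quad 0 \<kappa> \<kappa> \<kappa>)" and v: "\<And>i. 0 < v $ i"
  shows "at_stage T (n + 3) (iet_of vertex_c v) (hstreak h) (quad 0 (Suc \<kappa>) (Suc \<kappa>) (Suc \<kappa>))"
    "winner (rv_iter T n) = 1" "winner (rv_iter T (Suc n)) = 1" "winner (rv_iter T (Suc (Suc n))) = 1"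
    "loser (rv_iter T n) = 4" "loser (rv_iter T (Suc n)) = 3" "loser (rv_iter T (Suc (Suc n))) = 2"
proof -
  have v3: "\<And>i. 0 < shear 1 2 v $ i" and v4: "\<And>i. 0 < shear 1 3 (shear 1 2 v) $ i"
    using v by (auto simp: add_pos_pos)
  note 0 = assms(1)[unfolded streak_def o_apply]
  note 1 = at_stage_arrow[OF 0 arrows(7) v4, folded raise_def, unfolded if_False]
  note 2 = at_stage_arrow[OF 1 arrows(8) v3, folded raise_def, unfolded if_False]
  note 3 = at_stage_arrow[OF 2 arrows(9) v, folded raise_def, unfolded if_False]
  have "at_stage T (n + 3) (iet_of vertex_c v) (hstreak h) ((quad 0 \<kappa> \<kappa> \<kappa>)(4 := Suc \<kappa>, 3 := Suc \<kappa>, 2 := Suc \<kappa>))"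
    using 3 by (simp add: hstreak_def numeral_3_eq_3)
  moreover have "(quad 0 \<kappa> \<kappa> \<kappa>)(4 := Suc \<kappa>, 3 := Suc \<kappa>, 2 := Suc \<kappa>) = quad 0 (Suc \<kappa>) (Suc \<kappa>) (Suc \<kappa>)"
    by (simp add: fun_eq_iff forall_4)
  ultimately show "at_stage T (n + 3) (iet_of vertex_c v) (hstreak h) (quad 0 (Suc \<kappa>) (Suc \<kappa>) (Suc \<kappa>))" by simp
  show "winner (rv_iter T n) = 1" "loser (rv_iter T n) = 4"
    using 0 arrow_step[OF arrows(7) v4] by (auto simp: at_stage_def)
  show "winner (rv_iter T (Suc n)) = 1" "loser (rv_iter T (Suc n)) = 3"
    using 1 arrow_step[OF arrows(8) v3] by (auto simp: at_stage_def)
  show "winner (rv_iter T (Suc (Suc n))) = 1" "loser (rv_iter T (Suc (Suc n))) = 2"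
    using 2 arrow_step[OF arrows(9) v] by (auto simp: at_stage_def)
qed

lemma at_stage_streaks:
  assumes "at_stage T n (iet_of vertex_c ((streak ^^ N) v)) h (quad 0 \<kappa> \<kappa> \<kappa>)" and v: "\<And>i. 0 < v $ i" and "i \<le> N"
  shows "at_stage T (n + 3 * i) (iet_of vertex_c ((streak ^^ (N - i)) v)) ((hstreak ^^ i) h)
    (quad 0 (\<kappa> + i) (\<kappa> + i) (\<kappa> + i))"
  using assms(3)
proof (induction i)
  case 0
  then show ?case using assms by simp
next
  case (Suc i)
  then have eq: "(streak ^^ (N - i)) v = streak ((streak ^^ (N - Suc i)) v)"
    by (simp add: Suc_diff_Suc flip: funpow.simps(2)[THEN fun_cong, unfolded o_apply])
  have "at_stage T (n + 3 * i + 3) (iet_of vertex_c ((streak ^^ (N - Suc i)) v)) (hstreak ((hstreak ^^ i) h))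
      (quad 0 (Suc (\<kappa> + i)) (Suc (\<kappa> + i)) (Suc (\<kappa> + i)))"
    using Suc cone_pos(5)[OF v] by (intro at_stage_streak(1)) (auto simp: eq)
  then show ?case by (simp add: algebra_simps)
qed

text \<open>A never loses during the streak, so row 1 stays as it is, and every round adds it to the
  other rows. The entry in row 4, column 1 thus counts the rounds, and it bounds the norm of the
  Zorich step from below.\<close>

lemma streaks_matrix:
  assumes at: "at_stage T n (iet_of vertex_c ((streak ^^ N) v)) h (quad 0 \<kappa> \<kappa> \<kappa>)" and v: "\<And>i. 0 < v $ i" and "i \<le> N"
  shows "(\<forall>a b. 0 \<le> rv_matrix T n (n + 3 * i) $ a $ b) \<and> rv_matrix T n (n + 3 * i) $ 1 $ 1 = 1 \<and>
    real i \<le> rv_matrix T n (n + 3 * i) $ 4 $ 1"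
  using assms(3)
proof (induction i)
  case 0
  \<comment> \<open>For a successor \<open>n\<close> this is the default branch of
    \<open>rv_matrix\<close>, which yields the identity.\<close>
  have "rv_matrix T n n = mat 1" by (cases n) auto
  then show ?case by (auto simp: mat_def)
next
  case (Suc i)
  let ?n = "n + 3 * i"
  have eq: "(streak ^^ (N - i)) v = streak ((streak ^^ (N - Suc i)) v)"
    using Suc.prems by (simp add: Suc_diff_Suc flip: funpow.simps(2)[THEN fun_cong, unfolded o_apply])
  note s = at_stage_streak[OF at_stage_streaks[OF at v, of i, unfolded eq]]
  have w: "winner (rv_iter T ?n) = 1" "winner (rv_iter T (Suc ?n)) = 1" "winner (rv_iter T (Suc (Suc ?n))) = 1"
    "loser (rv_iter T ?n) = 4" "loser (rv_iter T (Suc ?n)) = 3" "loser (rv_iter T (Suc (Suc ?n))) = 2"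
    using s Suc.prems cone_pos(5)[OF v] by auto
  define Q where "Q = rv_matrix T n ?n"
  have Q: "rv_matrix T n (n + 3 * Suc i) $ a $ b =
      Q $ a $ b + (if a = 4 \<or> a = 3 \<or> a = 2 then Q $ 1 $ b else 0)" for a b
  proof -
    have "n + 3 * Suc i = Suc (Suc (Suc ?n))" by simp
    then have "rv_matrix T n (n + 3 * Suc i) = step_matrix (rv_iter T (Suc (Suc ?n))) **
        (step_matrix (rv_iter T (Suc ?n)) ** (step_matrix (rv_iter T ?n) ** Q))"
      by (simp only:) (simp add: Q_def)
    then show ?thesis using w by (auto simp: step_matrix_mult)
  qed
  show ?case unfolding Q using Suc by (auto simp: Q_def)
qed

lemma funpow_diff:
  assumes "i \<le> m"
  shows "(f ^^ m) v = (f ^^ i) ((f ^^ (m - i)) v)"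
  using assms fun_cong[OF funpow_add[of i "m - i" f], of v] by simp

text \<open>The streak starts at \<open>s\<close>, after one win of D over A, \<open>3 * m\<close>
  loop steps and two merging steps. D wins at \<open>n\<close> and again at \<open>s - 1\<close>, so
  the wins of A in different blocks cannot merge into one Zorich step.\<close>

lemma at_stage_block:
  assumes at: "at_stage T n (iet_of vertex_c (block m N v)) h (quad 0 \<kappa> \<kappa> \<kappa>)" and v: "\<And>i. 0 < v $ i"
  defines "s \<equiv> n + 3 * m + 3"
  shows "i \<le> m \<Longrightarrow> at_stage T (n + 1 + 3 * i) (iet_of vertex_v ((loop ^^ (m - i)) (merge ((streak ^^ N) v))))
      ((hloop ^^ i) (raise 1 4 h)) (quad 0 \<kappa> \<kappa> \<kappa>)"
    and "at_stage T s (iet_of vertex_c ((streak ^^ N) v)) (hmerge ((hloop ^^ m) (raise 1 4 h))) (quad 0 \<kappa> \<kappa> \<kappa>)"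
    and "at_stage T (s + 3 * N) (iet_of vertex_c v) (hblock m N h) (quad 0 (\<kappa> + N) (\<kappa> + N) (\<kappa> + N))"
    and "winner (rv_iter T n) = 4" "winner (rv_iter T (s - 1)) = 4"
proof -
  let ?w = "(streak ^^ N) v"
  have w: "\<And>i. 0 < ?w $ i" by (rule cone_pos(5)[OF v])
  have w3: "\<And>i. 0 < shear 4 3 ?w $ i" by (rule shear_pos[OF w])
  have mw: "\<And>i. 0 < merge ?w $ i" by (rule cone_pos(3)[OF w])
  have lw: "\<And>i j. 0 < (loop ^^ j) (merge ?w) $ i" by (rule cone_pos(4)[OF mw])
  note 0 = at[unfolded block_def o_apply]
  show "winner (rv_iter T n) = 4"
    using 0 arrow_step[OF arrows(1) lw] by (auto simp: at_stage_def)
  note 1 = at_stage_arrow[OF 0 arrows(1) lw, folded raise_def, unfolded if_True]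
  show st: "at_stage T (n + 1 + 3 * i) (iet_of vertex_v ((loop ^^ (m - i)) (merge ?w)))
      ((hloop ^^ i) (raise 1 4 h)) (quad 0 \<kappa> \<kappa> \<kappa>)" if "i \<le> m" for i
    using at_stage_loops[OF 1[unfolded funpow_diff[OF that]] lw] by simp
  have 2: "at_stage T (n + 1 + 3 * m) (iet_of vertex_v (shear 4 2 (shear 4 3 ?w))) ((hloop ^^ m) (raise 1 4 h)) (quad 0 \<kappa> \<kappa> \<kappa>)"
    using st[of m] by (simp add: merge_def)
  note 3 = at_stage_arrow[OF 2 arrows(5) w3, folded raise_def, unfolded if_True]
  note 4 = at_stage_arrow[OF 3 arrows(6) w, folded raise_def, unfolded if_True]
  show 5: "at_stage T s (iet_of vertex_c ?w) (hmerge ((hloop ^^ m) (raise 1 4 h))) (quad 0 \<kappa> \<kappa> \<kappa>)"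
    using 4 by (simp add: s_def hmerge_def numeral_3_eq_3)
  have s1: "s - 1 = Suc (n + 1 + 3 * m)" by (simp add: s_def)
  show "winner (rv_iter T (s - 1)) = 4"
    using 3 arrow_step[OF arrows(6) w] unfolding s1 by (auto simp: at_stage_def)
  show "at_stage T (s + 3 * N) (iet_of vertex_c v) (hblock m N h) (quad 0 (\<kappa> + N) (\<kappa> + N) (\<kappa> + N))"
    using at_stage_streaks[OF 5 v, of N] by (simp add: hblock_def)
qed

subsection \<open>Heights\<close>

text \<open>Comparability of the towers over B, C and D, with constants chosen so that a loop
  preserves them; the tower over A is left out on purpose.\<close>

definition balanced :: "(4 \<Rightarrow> nat) \<Rightarrow> bool" where
  "balanced h \<longleftrightarrow> h 2 \<le> h 3 \<and> h 3 \<le> 2 * h 2 \<and> h 4 \<le> 2 * h 2 \<and> h 2 \<le> 4 * h 4"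

lemma hloop_simps [simp]: "hloop h 1 = h 1" "hloop h 2 = h 2 + h 3" "hloop h 3 = h 2 + 2 * h 3" "hloop h 4 = h 4 + h 2"
  by (simp_all add: hloop_def raise_def)

lemma hmerge_simps [simp]: "hmerge h 1 = h 1" "hmerge h 2 = h 2 + h 4" "hmerge h 3 = h 3 + h 4" "hmerge h 4 = h 4"
  by (simp_all add: hmerge_def raise_def)

lemma raise_1_4_simps [simp]: "raise 1 4 h 1 = h 1 + h 4" "raise 1 4 h 2 = h 2" "raise 1 4 h 3 = h 3" "raise 1 4 h 4 = h 4"
  by (simp_all add: raise_def)

lemma hstreaks_simps [simp]: "(hstreak ^^ N) h 1 = h 1" "(hstreak ^^ N) h 2 = h 2 + N * h 1"
    "(hstreak ^^ N) h 3 = h 3 + N * h 1" "(hstreak ^^ N) h 4 = h 4 + N * h 1"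
  by (induction N) (simp_all add: hstreak_def raise_def)

text \<open>The heights of B and C are multiplied by the hyperbolic matrix with rows (1,1) and
  (1,2). The bounds \<open>h 2 \<le> h 3\<close> and \<open>h 3 \<le> 2 * h 2\<close> turn this into
  growth of \<open>h 2\<close> by a factor between 2 and 3, while A takes no part.\<close>

lemma hloops:
  assumes "balanced h"
  shows "balanced ((hloop ^^ i) h) \<and> (hloop ^^ i) h 1 = h 1 \<and>
    2 ^ i * h 2 \<le> (hloop ^^ i) h 2 \<and> (hloop ^^ i) h 2 \<le> 3 ^ i * h 2"
proof (induction i)
  case (Suc i)
  let ?g = "(hloop ^^ i) h"
  have b: "balanced ?g" and "2 ^ i * h 2 \<le> ?g 2" "?g 2 \<le> 3 ^ i * h 2" "?g 1 = h 1" using Suc by auto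
  moreover from b have "2 * ?g 2 \<le> ?g 2 + ?g 3" "?g 2 + ?g 3 \<le> 3 * ?g 2" by (auto simp: balanced_def)
  ultimately show ?case by (auto simp: balanced_def)
qed (use assms in simp)

text \<open>One loop improves the constant 4 in \<open>balanced\<close> to 3, because D has just
  received the height of B. The slack is spent in \<open>hmerge\<close>, which adds the height of D
  to that of B.\<close>

lemma hloops_balanced_strict:
  assumes "balanced h" "0 < i"
  shows "(hloop ^^ i) h 2 \<le> 3 * (hloop ^^ i) h 4"
proof -
  obtain j where i: "i = Suc j" using assms(2) gr0_implies_Suc by blast
  have "balanced ((hloop ^^ j) h)" using hloops[OF assms(1)] by blast
  then show ?thesis by (auto simp: i balanced_def)
qed

text \<open>The logarithm of the heights at the beginning of block \<open>k\<close> is \<open>O(stretch k)\<close>, so that the growth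
  within the block is a fixed power of everything that came before.\<close>

definition stretch :: "nat \<Rightarrow> nat" where "stretch k = 2 ^ k"
text \<open>Twice \<open>stretch k\<close> because each loop gains at least a factor 2: half of the
  loops compensate the \<open>streaks k\<close> rounds, the other half make the tower over A
  thin.\<close>

definition loops :: "nat \<Rightarrow> nat" where "loops k = 2 * stretch k"
definition streaks :: "nat \<Rightarrow> nat" where "streaks k = 2 ^ stretch k"

primrec heights :: "nat \<Rightarrow> 4 \<Rightarrow> nat" where
  "heights 0 = (\<lambda>_. 1)"
| "heights (Suc k) = hblock (loops k) (streaks k) (heights k)"

definition stage_heights :: "nat \<Rightarrow> nat \<Rightarrow> 4 \<Rightarrow> nat" where
  "stage_heights k i = (hloop ^^ i) (raise 1 4 (heights k))"

lemma stretch_pos: "1 \<le> stretch k" by (simp add: stretch_def)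

lemma loops_pos: "0 < loops k" using stretch_pos[of k] by (simp add: loops_def)

text \<open>The streak adds the same amount to B, C and D, so it respects the comparisons. As there
  is at least one round, D ends up at least as high as A; this lets the next block start with A of
  the order of B.\<close>

lemma heights_invariant:
  "balanced (heights k) \<and> heights k 1 \<le> heights k 4 \<and> 0 < heights k 2"
proof (induction k)
  case 0
  then show ?case by (simp add: balanced_def)
next
  case (Suc k)
  define g where "g = stage_heights k (loops k)"
  have b0: "balanced (raise 1 4 (heights k))" using Suc by (simp add: balanced_def)
  have b: "balanced g" "g 2 \<le> 3 * g 4" "g 1 = heights k 1 + heights k 4" "2 ^ loops k * heights k 2 \<le> g 2"
    using hloops[OF b0, of "loops k"] hloops_balanced_strict[OF b0 loops_pos[of k]] by (auto simp: g_def stage_heights_def)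
  have "0 < 2 ^ loops k * heights k 2" using Suc by simp
  then have pos: "0 < g 2" using b(4) by linarith
  have le: "g 1 \<le> streaks k * g 1" by (simp add: streaks_def)
  have "heights (Suc k) = (hstreak ^^ streaks k) (hmerge g)" by (simp add: hblock_def g_def stage_heights_def)
  then have "heights (Suc k) 1 = g 1" "heights (Suc k) 2 = g 2 + g 4 + streaks k * g 1"
    "heights (Suc k) 3 = g 3 + g 4 + streaks k * g 1" "heights (Suc k) 4 = g 4 + streaks k * g 1" by simp_all
  then show ?case using b(1,2) pos le unfolding balanced_def by linarith
qed

lemma stage_heights_bounds:
  shows "balanced (stage_heights k i)" "stage_heights k i 1 = heights k 1 + heights k 4"
    "2 ^ i * heights k 2 \<le> stage_heights k i 2" "stage_heights k i 2 \<le> 3 ^ i * heights k 2"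
    "0 < stage_heights k i 2"
proof -
  have b0: "balanced (raise 1 4 (heights k))" using heights_invariant[of k] by (simp add: balanced_def)
  note b = hloops[OF b0, of i]
  show "balanced (stage_heights k i)" "stage_heights k i 1 = heights k 1 + heights k 4"
    and 1: "2 ^ i * heights k 2 \<le> stage_heights k i 2" and "stage_heights k i 2 \<le> 3 ^ i * heights k 2"
    using b by (auto simp: stage_heights_def)
  have "0 < 2 ^ i * heights k 2" using heights_invariant[of k] by simp
  then show "0 < stage_heights k i 2" using 1 by linarith
qed

lemma stage_heights_1_le: "stage_heights k i 1 \<le> 4 * heights k 2"
  using stage_heights_bounds(2)[of k i] heights_invariant[of k] by (auto simp: balanced_def)

lemma stage_heights_Suc: "stage_heights k (Suc i) 2 \<le> 3 * stage_heights k i 2"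
  using stage_heights_bounds(1)[of k i] by (auto simp: stage_heights_def balanced_def)

text \<open>The constant is 7 = 1 + 2 + 4: the tower over B itself, that over D added by the merge,
  and the streak. The latter is at most 4 times the height of B because its rounds, numbering 2^l,
  are outweighed by the growth 2^(2l) in the loops.\<close>

lemma heights_Suc:
  "stage_heights k (loops k) 2 \<le> heights (Suc k) 2" "heights (Suc k) 2 \<le> 7 * stage_heights k (loops k) 2"
proof -
  let ?g = "stage_heights k (loops k)"
  have h: "heights (Suc k) 2 = ?g 2 + ?g 4 + streaks k * ?g 1"
    by (simp add: hblock_def stage_heights_def)
  then show "?g 2 \<le> heights (Suc k) 2" by simp
  have "streaks k \<le> 2 ^ loops k" unfolding streaks_def loops_def by (intro power_increasing) auto
  then have "streaks k * ?g 1 \<le> 2 ^ loops k * (4 * heights k 2)"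
    by (intro mult_mono stage_heights_1_le) auto
  also have "\<dots> \<le> 4 * ?g 2" using stage_heights_bounds(3)[of "loops k" k] by simp
  finally have "streaks k * ?g 1 \<le> 4 * ?g 2" .
  moreover have "?g 4 \<le> 2 * ?g 2" using stage_heights_bounds(1)[of k "loops k"] by (simp add: balanced_def)
  ultimately show "heights (Suc k) 2 \<le> 7 * ?g 2" using h by linarith
qed

text \<open>63 = 7 * 9: a block multiplies the height by at most 7 * 9^l, which is at most 63^l, and
  this squares the bound just as \<open>stretch\<close> doubles.\<close>

lemma heights_le: "heights k 2 \<le> 63 ^ stretch k"
proof (induction k)
  case (Suc k)
  have "heights (Suc k) 2 \<le> 7 * (3 ^ loops k * heights k 2)"
    using heights_Suc(2)[of k] stage_heights_bounds(4)[of k "loops k"] by linarith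
  also have "\<dots> = 7 * 9 ^ stretch k * heights k 2" by (simp add: loops_def power_mult)
  also have "\<dots> \<le> 7 ^ stretch k * 9 ^ stretch k * 63 ^ stretch k"
    using Suc stretch_pos[of k] by (intro mult_mono) (auto simp: self_le_power)
  also have "\<dots> = 63 ^ stretch (Suc k)"
    by (simp add: stretch_def mult_2 power_add flip: power_mult_distrib)
  finally show ?case .
qed simp

text \<open>9 * 63 = 567 is below 1024 = 2^10. The exponents 1/10 and 1/20 used later come from
  here.\<close>

lemma stage_heights_le: "i \<le> loops k \<Longrightarrow> stage_heights k i 2 \<le> 2 ^ (10 * stretch k)"
proof -
  assume "i \<le> loops k"
  have "stage_heights k i 2 \<le> 3 ^ i * heights k 2" by (rule stage_heights_bounds)
  also have "\<dots> \<le> 3 ^ loops k * 63 ^ stretch k"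
    using heights_le[of k] \<open>i \<le> loops k\<close> by (intro mult_mono power_increasing) auto
  also have "\<dots> = 567 ^ stretch k" by (simp add: loops_def power_mult flip: power_mult_distrib)
  also have "\<dots> \<le> 1024 ^ stretch k" by (intro power_mono) auto
  also have "\<dots> = 2 ^ (10 * stretch k)" by (simp add: power_mult)
  finally show ?thesis .
qed

lemma heights_ge: "2 ^ k \<le> heights k 2"
proof (induction k)
  case (Suc k)
  have "2 * heights k 2 \<le> 2 ^ loops k * heights k 2"
    using loops_pos[of k] self_le_power[of 2 "loops k"] by (intro mult_right_mono) auto
  moreover have "2 ^ Suc k = 2 * (2::nat) ^ k" by simp
  ultimately show ?case using Suc stage_heights_bounds(3)[of "loops k" k] heights_Suc(1)[of k] by linarith
qed simp

text \<open>The height of B never jumps by much: by a factor of at most 3 in a loop and at most 7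
  across the end of a block, the whole streak included.\<close>

lemma stage_exists:
  fixes y :: real
  assumes "1 \<le> y"
  obtains k i where "i \<le> loops k" "stage_heights k i 2 \<le> y" "y < 7 * stage_heights k i 2"
proof -
  have "\<exists>k. y < heights k 2"
  proof -
    obtain k where "y < 2 ^ k" using real_arch_pow[of 2 y] by auto
    moreover have "(2::real) ^ k \<le> heights k 2" using heights_ge[of k] by (metis of_nat_le_iff of_nat_numeral of_nat_power)
    ultimately show ?thesis by (intro exI[of _ k]) linarith
  qed
  then obtain k where k: "\<And>j. j < k \<Longrightarrow> \<not> y < heights j 2" "y < heights k 2"
    using exists_least_iff[of "\<lambda>k. y < heights k 2"] by blast
  have "k \<noteq> 0" using k assms by (cases k) auto
  then obtain q where q: "k = Suc q" by (cases k) auto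
  have le: "heights q 2 \<le> y" using k(1)[of q] q by simp
  have s0: "stage_heights q 0 2 = heights q 2" by (simp add: stage_heights_def)
  show ?thesis
  proof (cases "\<exists>i\<le>loops q. y < stage_heights q i 2")
    case True
    then obtain i where i: "\<And>j. j < i \<Longrightarrow> \<not> (j \<le> loops q \<and> y < stage_heights q j 2)" "i \<le> loops q" "y < stage_heights q i 2"
      using exists_least_iff[of "\<lambda>i. i \<le> loops q \<and> y < stage_heights q i 2"] by blast
    have "i \<noteq> 0" using i(3) le s0 by (cases i) auto
    then obtain j where j: "i = Suc j" by (cases i) auto
    have "stage_heights q j 2 \<le> y" using i(1)[of j] i(2) j by auto
    moreover have "y < 7 * stage_heights q j 2"
      using stage_heights_Suc[of q j] stage_heights_bounds(5)[of q j] i(3) j by (simp add: of_nat_le_iff[symmetric, where 'a=real])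
    ultimately show ?thesis using that[of j q] i(2) j by simp
  next
    case False
    then have "stage_heights q (loops q) 2 \<le> y" by (auto simp: not_less)
    moreover have "y < 7 * stage_heights q (loops q) 2"
      using heights_Suc(2)[of q] k(2) q by (simp add: of_nat_le_iff[symmetric, where 'a=real] del: heights.simps)
    ultimately show ?thesis using that[of "loops q" q] by simp
  qed
qed

subsection \<open>The Zorich acceleration\<close>

text \<open>The change of winner at \<open>n\<close> bounds the set under \<open>GREATEST\<close>,
  so that its value is determined.\<close>

lemma zorich_time_Suc:
  assumes c: "zorich_time T k < n" "\<And>j. zorich_time T k \<le> j \<Longrightarrow> j < n \<Longrightarrow> winner (rv_iter T j) = \<alpha>"
    and d: "winner (rv_iter T n) \<noteq> \<alpha>"
  shows "zorich_time T (Suc k) = n"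
  unfolding zorich_time.simps
proof (rule Greatest_equality)
  show "zorich_time T k < n \<and> (\<exists>\<alpha>. \<forall>j\<in>{zorich_time T k..<n}. winner (rv_iter T j) = \<alpha>)"
    using c by auto
next
  fix m assume m: "zorich_time T k < m \<and> (\<exists>\<alpha>. \<forall>j\<in>{zorich_time T k..<m}. winner (rv_iter T j) = \<alpha>)"
  then obtain \<beta> where \<beta>: "\<And>j. zorich_time T k \<le> j \<Longrightarrow> j < m \<Longrightarrow> winner (rv_iter T j) = \<beta>" by auto
  have "\<beta> = \<alpha>" using \<beta>[of "zorich_time T k"] c(2)[of "zorich_time T k"] c(1) m by auto
  then show "m \<le> n" using \<beta>[of n] d c(1) by (meson less_imp_le not_le)
qed

text \<open>Every change of winner is a Zorich time: if the first Zorich time from \<open>s\<close>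
  on were later than \<open>s\<close>, then \<open>s - 1\<close> and \<open>s\<close> would lie in
  the same run of a single winner. The hypothesis \<open>ch\<close> makes all runs finite.\<close>

lemma zorich_time_exists:
  assumes ch: "\<And>n. \<exists>m>n. winner (rv_iter T m) \<noteq> winner (rv_iter T n)"
    and s: "0 < s" "winner (rv_iter T (s - 1)) \<noteq> winner (rv_iter T s)"
  shows "\<exists>k\<ge>1. zorich_time T k = s"
proof -
  have next_change: "\<exists>n. zorich_time T k < n \<and> (\<forall>j. zorich_time T k \<le> j \<and> j < n \<longrightarrow> winner (rv_iter T j) = winner (rv_iter T (zorich_time T k)))
      \<and> winner (rv_iter T n) \<noteq> winner (rv_iter T (zorich_time T k))" for k
  proof -
    let ?z = "zorich_time T k"
    let ?P = "\<lambda>m. ?z < m \<and> winner (rv_iter T m) \<noteq> winner (rv_iter T ?z)"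
    have ex: "\<exists>m. ?P m" using ch by blast
    have "?P (LEAST m. ?P m)" using ex by (rule LeastI_ex)
    moreover have "winner (rv_iter T j) = winner (rv_iter T ?z)" if "?z \<le> j" "j < (LEAST m. ?P m)" for j
      using not_less_Least[OF that(2)] that(1) by (cases "j = ?z") auto
    ultimately show ?thesis by blast
  qed
  have step: "zorich_time T k < zorich_time T (Suc k) \<and>
      (\<forall>j. zorich_time T k \<le> j \<and> j < zorich_time T (Suc k) \<longrightarrow> winner (rv_iter T j) = winner (rv_iter T (zorich_time T k)))" for k
    using next_change[of k] zorich_time_Suc[of T k] by metis
  have "k \<le> zorich_time T k" for k
    by (induction k) (use step in \<open>auto simp: Suc_le_eq intro: le_less_trans simp del: zorich_time.simps(2)\<close>)
  then have "\<exists>k. s \<le> zorich_time T k" by blast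
  then obtain k where k: "\<And>j. j < k \<Longrightarrow> \<not> s \<le> zorich_time T j" "s \<le> zorich_time T k"
    using exists_least_iff[of "\<lambda>k. s \<le> zorich_time T k"] by blast
  have "k \<noteq> 0" using k(2) s(1) by (cases k) auto
  then obtain q where q: "k = Suc q" by (cases k) auto
  have lt: "zorich_time T q < s" using k(1)[of q] q by simp
  have "s = zorich_time T k"
  proof (rule ccontr)
    assume "s \<noteq> zorich_time T k"
    then have "s < zorich_time T (Suc q)" using k(2) q by simp
    then have "winner (rv_iter T (s - 1)) = winner (rv_iter T (zorich_time T q))"
      "winner (rv_iter T s) = winner (rv_iter T (zorich_time T q))"
    proof -
      have "zorich_time T q \<le> s - 1" "s - 1 < zorich_time T (Suc q)" "zorich_time T q \<le> s"
        using \<open>s < zorich_time T (Suc q)\<close> lt by linarith+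
      then show "winner (rv_iter T (s - 1)) = winner (rv_iter T (zorich_time T q))"
        "winner (rv_iter T s) = winner (rv_iter T (zorich_time T q))"
        using step[of q] \<open>s < zorich_time T (Suc q)\<close> by blast+
    qed
    then show False using s(2) by simp
  qed
  then show ?thesis using \<open>k \<noteq> 0\<close> by (intro exI[of _ k]) auto
qed

lemma entry_norm_at_stage:
  assumes "at_stage T n S h K"
  shows "entry_norm (rv_matrix T 0 n) = (\<Sum>i\<in>UNIV. real (h i))"
  using assms by (simp add: at_stage_def entry_norm_def)

lemma entry_le_entry_norm: "\<bar>A $ a $ b\<bar> \<le> entry_norm A" for A :: "real^'m^'n"
proof -
  have "\<bar>A $ a $ b\<bar> \<le> (\<Sum>j\<in>UNIV. \<bar>A $ a $ j\<bar>)" by (rule member_le_sum) auto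
  also have "\<dots> \<le> entry_norm A" unfolding entry_norm_def
    by (rule member_le_sum[of a UNIV "\<lambda>i. \<Sum>j\<in>UNIV. \<bar>A $ i $ j\<bar>"]) (auto intro: sum_nonneg)
  finally show ?thesis .
qed

subsection \<open>The interval exchange map\<close>

lemma streak_nth [simp]: "streak v $ 1 = v $ 1 + v $ 2 + v $ 3 + v $ 4" "streak v $ 2 = v $ 2" "streak v $ 3 = v $ 3" "streak v $ 4 = v $ 4"
  by (simp_all add: streak_def)

lemma streaks_nth: "(streak ^^ N) v $ 1 = v $ 1 + real N * (v $ 2 + v $ 3 + v $ 4) \<and> (streak ^^ N) v $ 2 = v $ 2 \<and>
    (streak ^^ N) v $ 3 = v $ 3 \<and> (streak ^^ N) v $ 4 = v $ 4"
  by (induction N) (simp_all add: algebra_simps)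

lemma loop_nth [simp]: "loop v $ 1 = v $ 1" "loop v $ 2 = v $ 2 + v $ 3 + v $ 4" "loop v $ 3 = v $ 2 + 2 * v $ 3" "loop v $ 4 = v $ 4"
  by (simp_all add: loop_def)

lemma loops_nth: "(loop ^^ i) v $ 1 = v $ 1 \<and> (loop ^^ i) v $ 4 = v $ 4"
  by (induction i) simp_all

lemma merge_nth [simp]: "merge v $ 1 = v $ 1" "merge v $ 2 = v $ 2" "merge v $ 3 = v $ 3" "merge v $ 4 = v $ 4 + v $ 3 + v $ 2"
  by (simp_all add: merge_def)

lemma block_nth:
  "block m N v $ 1 = (streak ^^ N) v $ 1" "block m N v $ 4 = v $ 2 + v $ 3 + v $ 4 + (streak ^^ N) v $ 1"
  "block m N v $ 2 = (loop ^^ m) (merge ((streak ^^ N) v)) $ 2" "block m N v $ 3 = (loop ^^ m) (merge ((streak ^^ N) v)) $ 3"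
  using loops_nth[of m "merge ((streak ^^ N) v)"] streaks_nth[of N v] by (simp_all add: block_def)

locale nested_blocks =
  fixes v :: "nat \<Rightarrow> real^4"
  assumes v: "\<And>k. v k = block (loops k) (streaks k) (v (Suc k))"
    and nonneg: "\<And>k i. 0 \<le> v k $ i" and total: "(\<Sum>i\<in>UNIV. v 0 $ i) = 1"
begin

lemma streaks_ge_1: "1 \<le> streaks k" by (simp add: streaks_def)

lemma nonzero: "v k \<noteq> 0"
proof (induction k)
  case 0
  then show ?case using total by auto
next
  case (Suc k)
  have "block (loops k) (streaks k) 0 = 0"
    using cone_maps(4) unfolding cone_map_def by (blast intro: linear_0)
  then show ?case using Suc v[of k] by auto
qed

text \<open>Compactness yields nonnegative vectors only. Any nonzero entry of
  \<open>v (Suc k)\<close> reaches A through the streak and then D through the first arrow of the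
  block.\<close>

lemma pos_1_4: "0 < v k $ 1" "0 < v k $ 4"
proof -
  let ?u = "v (Suc k)" and ?w = "(streak ^^ streaks k) (v (Suc k))"
  have "\<exists>i. ?u $ i \<noteq> 0" using nonzero[of "Suc k"] by (auto simp: vec_eq_iff)
  then have "0 < ?u $ 1 \<or> 0 < ?u $ 2 \<or> 0 < ?u $ 3 \<or> 0 < ?u $ 4"
    using nonneg[of "Suc k"] exhaust_4 by (metis less_eq_real_def)
  then have s: "0 < ?u $ 1 + (?u $ 2 + ?u $ 3 + ?u $ 4)"
    using nonneg[of "Suc k" 1] nonneg[of "Suc k" 2] nonneg[of "Suc k" 3] nonneg[of "Suc k" 4] by linarith
  define a where "a = ?u $ 2 + ?u $ 3 + ?u $ 4"
  have a: "0 \<le> a" using nonneg[of "Suc k"] by (simp add: a_def)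
  have "1 * a \<le> real (streaks k) * a" using streaks_ge_1[of k] a by (intro mult_right_mono) auto
  moreover have "?w $ 1 = ?u $ 1 + real (streaks k) * a" by (simp only: streaks_nth a_def)
  ultimately have w: "0 < ?w $ 1" using s unfolding a_def[symmetric] by linarith
  show "0 < v k $ 1" using w by (simp only: v[of k] block_nth)
  have "v k $ 4 = a + ?w $ 1" by (simp only: v[of k] block_nth a_def)
  then show "0 < v k $ 4" using w a by simp
qed

lemma pos: "0 < v k $ i"
proof -
  let ?x = "merge ((streak ^^ streaks k) (v (Suc k)))"
  have w: "0 \<le> (streak ^^ streaks k) (v (Suc k)) $ i" for i
    using nonneg[of "Suc k"] by (rule cone_map_nonneg[OF cone_map_funpow[OF cone_maps(2)]])
  have x: "0 \<le> ?x $ i" for i using w by (rule cone_map_nonneg[OF cone_maps(3)])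
  have x4: "0 < ?x $ 4" using w[of 2] w[of 3] pos_1_4(2)[of "Suc k"] streaks_nth[of "streaks k" "v (Suc k)"] by simp
  \<comment> \<open>Two loops are split off: the first passes the positive length of D on to B, the
    second passes that of B on to C.\<close>
  obtain m where m: "loops k = Suc (Suc m)"
    using stretch_pos[of k] by (metis One_nat_def Suc_le_D add_2_eq_Suc loops_def mult_2 nat_1_add_1 add_Suc_right add_Suc)
  define y where "y = (loop ^^ m) ?x"
  have y: "0 \<le> y $ i" "0 < y $ 4" for i
    using cone_map_nonneg[OF cone_map_funpow[OF cone_maps(1)] x] loops_nth[of m ?x] x4 by (auto simp: y_def)
  have "(loop ^^ loops k) ?x = loop (loop y)" by (simp add: m y_def)
  then have "0 < (loop ^^ loops k) ?x $ 2" "0 < (loop ^^ loops k) ?x $ 3"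
    using y(1)[of 2] y(1)[of 3] y(2) by simp_all
  then have "0 < v k $ 2" "0 < v k $ 3" unfolding v[of k] block_nth by blast+
  then show ?thesis using pos_1_4[of k] exhaust_4[of i] by auto
qed

text \<open>The block begins with a win of D over A.\<close>

lemma v_1_le_4: "v k $ 1 \<le> v k $ 4"
  using nonneg[of "Suc k"] unfolding v[of k] block_nth by simp

definition T :: "4 iet" where "T = iet_of vertex_c (v 0)"

lemma T_iet: "is_iet T"
  using pos bij_quads by (simp add: T_def iet_of_def is_iet_def)

lemma T_total: "total_len T = 1"
  using total by (simp add: T_def iet_of_def total_len_def)

text \<open>A is first in the top row and last in the bottom row.\<close>

lemma T_admissible: "admissible T"
proof -
  have "1 \<in> pi_t T -` {1..k} \<and> 1 \<notin> pi_b T -` {1..k}" if "k \<in> {1..CARD(4) - 1}" for k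
    using that by (auto simp: T_def iet_of_def)
  then show ?thesis unfolding admissible_def by metis
qed

primrec time :: "nat \<Rightarrow> nat" where
  "time 0 = 0"
| "time (Suc k) = time k + 3 * loops k + 3 + 3 * streaks k"

lemma at_stage_time: "\<exists>\<kappa>\<ge>k. at_stage T (time k) (iet_of vertex_c (v k)) (heights k) (quad 0 \<kappa> \<kappa> \<kappa>)"
proof (induction k)
  case 0
  have "quad 0 0 0 0 = (\<lambda>_. 0)" by (simp add: quad_def fun_eq_iff)
  then show ?case using at_stage_init[OF T_iet] by (intro exI[of _ 0]) (simp add: T_def)
next
  case (Suc k)
  then obtain \<kappa> where \<kappa>: "k \<le> \<kappa>" "at_stage T (time k) (iet_of vertex_c (block (loops k) (streaks k) (v (Suc k)))) (heights k) (quad 0 \<kappa> \<kappa> \<kappa>)"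
    unfolding v[of k, symmetric] by blast
  have "at_stage T (time (Suc k)) (iet_of vertex_c (v (Suc k))) (heights (Suc k)) (quad 0 (\<kappa> + streaks k) (\<kappa> + streaks k) (\<kappa> + streaks k))"
    using at_stage_block(3)[OF \<kappa>(2) pos] by (simp add: add.assoc)
  then show ?case using \<kappa>(1) streaks_ge_1[of k] by (intro exI[of _ "\<kappa> + streaks k"]) auto
qed

lemma T_keane: "keane T"
proof (rule keaneI[OF T_iet])
  fix \<beta> m assume "1 < pi_t T \<beta>"
  then have "\<beta> \<noteq> 1" by (auto simp: T_def iet_of_def)
  obtain \<kappa> where \<kappa>: "m \<le> \<kappa>" "at_stage T (time m) (iet_of vertex_c (v m)) (heights m) (quad 0 \<kappa> \<kappa> \<kappa>)"
    using at_stage_time[of m] by blast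
  then obtain k u where "towers T (iet_of vertex_c (v m)) (heights m) k u" "quad 0 \<kappa> \<kappa> \<kappa> \<beta> \<le> k \<beta>"
    unfolding at_stage_def by blast
  moreover have "quad 0 \<kappa> \<kappa> \<kappa> \<beta> = \<kappa>" using \<open>\<beta> \<noteq> 1\<close> by (simp add: quad_def)
  ultimately show "\<exists>S h k u. towers T S h k u \<and> m \<le> k \<beta>" using \<kappa>(1) by (metis order_trans)
qed

lemma block_stage:
  obtains \<kappa> where "at_stage T (time k) (iet_of vertex_c (block (loops k) (streaks k) (v (Suc k)))) (heights k) (quad 0 \<kappa> \<kappa> \<kappa>)"
  using at_stage_time[of k] unfolding v[of k, symmetric] by blast

subsubsection \<open>Condition (R)\<close>

text \<open>After the streak B, C and D have heights at least X/4, where X is the height of B at the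
  end of the loops. Since all towers have total area 1, their lengths sum to at most 4/X, and A is
  no longer than D then. Undoing the 2^l rounds gives A at most (1 + 2^l) * 4/X.\<close>

lemma thin_letter: "(streak ^^ streaks k) (v (Suc k)) $ 1 \<le> 8 * 2 ^ stretch k / real (stage_heights k (loops k) 2)"
proof -
  define u X where "u = v (Suc k)" and "X = real (stage_heights k (loops k) 2)"
  have X: "0 < X" using stage_heights_bounds(5)[of k "loops k"] by (simp add: X_def)
  obtain k' u' where "towers T (iet_of vertex_c u) (heights (Suc k)) k' u'"
    using at_stage_time[of "Suc k"] unfolding at_stage_def u_def by blast
  then have "(\<Sum>\<gamma>\<in>UNIV. real (heights (Suc k) \<gamma>) * u $ \<gamma>) = 1"
    by (simp add: towers_def T_total iet_of_def del: heights.simps)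
  then have s: "real (heights (Suc k) 1) * u $ 1 + real (heights (Suc k) 2) * u $ 2 + real (heights (Suc k) 3) * u $ 3
      + real (heights (Suc k) 4) * u $ 4 = 1" by (simp add: sum_4 del: heights.simps)
  have b: "heights (Suc k) 2 \<le> heights (Suc k) 3" "heights (Suc k) 2 \<le> 4 * heights (Suc k) 4"
    using heights_invariant[of "Suc k"] unfolding balanced_def by blast+
  have X2: "X \<le> real (heights (Suc k) 2)" using heights_Suc(1)[of k] unfolding X_def by (simp del: heights.simps)
  then have X34: "X \<le> real (heights (Suc k) 3)" "X \<le> 4 * real (heights (Suc k) 4)" using b by linarith+
  have u: "0 < u $ i" for i unfolding u_def by (rule pos)
  have "X / 4 * u $ 2 \<le> real (heights (Suc k) 2) * u $ 2" "X / 4 * u $ 3 \<le> real (heights (Suc k) 3) * u $ 3"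
    "X / 4 * u $ 4 \<le> real (heights (Suc k) 4) * u $ 4"
    using X2 X34 X u by (intro mult_right_mono; simp add: less_imp_le)+
  moreover have "0 \<le> real (heights (Suc k) 1) * u $ 1" using u[of 1] by simp
  ultimately have "X / 4 * u $ 2 + X / 4 * u $ 3 + X / 4 * u $ 4 \<le> 1" using s by linarith
  then have sm: "u $ 2 + u $ 3 + u $ 4 \<le> 4 / X" using X by (simp add: field_simps)
  have u1: "u $ 1 \<le> u $ 2 + u $ 3 + u $ 4" using v_1_le_4[of "Suc k"] u[of 2] u[of 3] by (simp add: u_def)
  have "(streak ^^ streaks k) u $ 1 \<le> (1 + real (streaks k)) * (u $ 2 + u $ 3 + u $ 4)"
    using streaks_nth[of "streaks k" u] u1 by (simp add: algebra_simps)
  also have "\<dots> \<le> (2 * 2 ^ stretch k) * (4 / X)"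
    using sm u X by (intro mult_mono) (auto simp: streaks_def add_pos_pos less_imp_le)
  finally show ?thesis by (simp add: u_def X_def)
qed

lemma T_thin_towers: "thin_towers T 224 (1 / 10)"
  unfolding thin_towers_def
proof (intro allI impI)
  fix y :: real assume "1 \<le> y"
  then obtain k i where i: "i \<le> loops k" and y: "stage_heights k i 2 \<le> y" "y < 7 * stage_heights k i 2"
    by (rule stage_exists)
  obtain \<kappa> where "at_stage T (time k) (iet_of vertex_c (block (loops k) (streaks k) (v (Suc k)))) (heights k) (quad 0 \<kappa> \<kappa> \<kappa>)"
    by (rule block_stage)
  note at = at_stage_block(1)[OF this pos i]
  define w where "w = (streak ^^ streaks k) (v (Suc k))"
  define S where "S = iet_of vertex_v ((loop ^^ (loops k - i)) (merge w))"
  define h where "h = stage_heights k i"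
  obtain k' u where tw: "towers T S h k' u"
    using at unfolding at_stage_def S_def h_def stage_heights_def w_def by blast
  have bal: "balanced h" and h1: "h 1 \<le> 4 * heights k 2" and lo: "2 ^ i * heights k 2 \<le> h 2"
    unfolding h_def by (rule stage_heights_bounds stage_heights_1_le)+
  have "1 * heights k 2 \<le> 2 ^ i * heights k 2" by (rule mult_right_mono) auto
  then have h12: "h 1 \<le> 4 * h 2" using h1 lo by linarith
  have y: "real (h 2) \<le> y" "y < 7 * real (h 2)" using y by (simp_all add: h_def)
  have b: "real (h 2) \<le> real (h 3)" "real (h 3) \<le> 2 * real (h 2)" "real (h 4) \<le> 2 * real (h 2)" "real (h 2) \<le> 4 * real (h 4)" "real (h 1) \<le> 4 * real (h 2)"
    using bal h12 unfolding balanced_def by linarith+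
  \<comment> \<open>Neither the loops nor the merge change the length of A, so the bound at the
    start of the streak holds at every stage \<open>i\<close>.\<close>
  have "len S 1 = w $ 1" using loops_nth[of "loops k - i" "merge w"] by (simp add: S_def iet_of_def)
  then have l1: "len S 1 \<le> 8 * 2 ^ stretch k / real (stage_heights k (loops k) 2)" using thin_letter[of k] by (simp add: w_def)
  have "2 ^ loops k * heights k 2 \<le> stage_heights k (loops k) 2" by (rule stage_heights_bounds)
  then have lo': "2 ^ loops k * real (heights k 2) \<le> real (stage_heights k (loops k) 2)"
    by (metis of_nat_le_iff of_nat_mult of_nat_numeral of_nat_power)
  have hk: "0 < real (heights k 2)" using heights_invariant[of k] by simp
  have l2: "(2::real) ^ loops k = 2 ^ stretch k * 2 ^ stretch k" by (simp add: loops_def mult_2 power_add)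
  \<comment> \<open>Here \<open>heights k 2\<close> cancels: it bounds the height of A up to the
    factor 4, while the bound on the length has 2^(2l) times it in the denominator. What remains is
    32 * 2^l / 2^(2l).\<close>
  have "real (h 1) * len S 1 \<le> (4 * real (heights k 2)) * (8 * 2 ^ stretch k / real (stage_heights k (loops k) 2))"
    using h1 l1 tw is_ietD(4)[of S 1] by (intro mult_mono) (auto simp: towers_def)
  also have "\<dots> \<le> (4 * real (heights k 2)) * (8 * 2 ^ stretch k / (2 ^ loops k * real (heights k 2)))"
    using lo' hk by (intro mult_left_mono divide_left_mono) (auto intro!: mult_pos_pos less_le_trans[OF _ lo'])
  also have "\<dots> = 32 / 2 ^ stretch k" using hk by (simp add: l2 field_simps)
  finally have area: "real (h 1) * len S 1 \<le> 32 / 2 ^ stretch k" .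
  have "h 2 \<le> 2 ^ (10 * stretch k)" unfolding h_def by (rule stage_heights_le[OF i])
  then have "real (h 2) \<le> 2 ^ (10 * stretch k)" by (metis of_nat_le_iff of_nat_numeral of_nat_power)
  then have "y \<le> 7 * 2 ^ (10 * stretch k)" using y by linarith
  \<comment> \<open>The 7 is enlarged to 7^10 so that the tenth root becomes 7 * 2^l; this gives 224
    = 7 * 32.\<close>
  also have "\<dots> \<le> 7 powr 10 * 2 ^ (10 * stretch k)" by simp
  also have "\<dots> = (7 * 2 ^ stretch k) powr 10" by (simp add: powr_mult powr_realpow[symmetric] powr_powr mult.commute)
  finally have "y powr (1 / 10) \<le> ((7 * 2 ^ stretch k) powr 10) powr (1 / 10)"
    using \<open>1 \<le> y\<close> by (intro powr_mono2) auto
  then have "y powr (1 / 10) \<le> 7 * 2 ^ stretch k" unfolding powr_powr by simp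
  then have "32 / 2 ^ stretch k \<le> 224 / y powr (1 / 10)"
    using \<open>1 \<le> y\<close> by (simp add: field_simps)
  then have area': "real (h 1) * len S 1 \<le> 224 * y powr (- (1 / 10))"
    using area unfolding powr_minus divide_inverse by linarith
  have 1: "y \<le> 224 * real (h \<gamma>)" if "\<gamma> \<noteq> 1" for \<gamma>
  proof -
    have "\<gamma> = 2 \<or> \<gamma> = 3 \<or> \<gamma> = 4" using that exhaust_4[of \<gamma>] by blast
    then show ?thesis using y b by (elim disjE) auto
  qed
  have 2: "(\<Sum>\<gamma>\<in>UNIV. real (h \<gamma>)) \<le> 224 * y" unfolding sum_4 using y b by linarith
  show "\<exists>S h k u \<alpha>. towers T S h k u \<and> (\<forall>\<gamma>. \<gamma> \<noteq> \<alpha> \<longrightarrow> y \<le> 224 * real (h \<gamma>)) \<and>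
     (\<Sum>\<gamma>\<in>UNIV. real (h \<gamma>)) \<le> 224 * y \<and> real (h \<alpha>) * len S \<alpha> \<le> 224 * y powr (- (1 / 10))"
    using tw 1 2 area' by blast
qed

subsubsection \<open>Failure of condition (Z)\<close>

definition streak_start :: "nat \<Rightarrow> nat" where "streak_start k = time k + 3 * loops k + 3"

lemma streak_start:
  "at_stage T (streak_start k) (iet_of vertex_c ((streak ^^ streaks k) (v (Suc k)))) (hmerge (stage_heights k (loops k))) (quad 0 \<kappa> \<kappa> \<kappa>) \<Longrightarrow>
   j < 3 * streaks k \<Longrightarrow> winner (rv_iter T (streak_start k + j)) = 1"
proof -
  assume at: "at_stage T (streak_start k) (iet_of vertex_c ((streak ^^ streaks k) (v (Suc k)))) (hmerge (stage_heights k (loops k))) (quad 0 \<kappa> \<kappa> \<kappa>)"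
    and j: "j < 3 * streaks k"
  define i where "i = j div 3"
  have i: "Suc i \<le> streaks k" using j by (auto simp: i_def)
  have eq: "(streak ^^ (streaks k - i)) (v (Suc k)) = streak ((streak ^^ (streaks k - Suc i)) (v (Suc k)))"
    using i by (simp add: Suc_diff_Suc flip: funpow.simps(2)[THEN fun_cong, unfolded o_apply])
  have p: "\<And>a. 0 < (streak ^^ (streaks k - Suc i)) (v (Suc k)) $ a" by (rule cone_pos(5)[OF pos])
  have "i \<le> streaks k" using i by simp
  note w = at_stage_streak[OF at_stage_streaks[OF at pos this, unfolded eq] p]
  have "j = 3 * i \<or> j = Suc (3 * i) \<or> j = Suc (Suc (3 * i))" unfolding i_def by presburger
  then show ?thesis using w(2-4) by auto
qed

text \<open>D wins just before the streak and again at its end, where the next block begins, so the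
  streak of A is exactly one Zorich step.\<close>

lemma zorich_streak:
  "\<exists>q\<ge>1. entry_norm (zorich_matrix T 0 q) \<le> 13 * 2 ^ (10 * stretch k) \<and> 2 ^ stretch k \<le> entry_norm (zorich_matrix T q (q + 1))"
proof -
  have facts: "\<exists>\<kappa>. at_stage T (streak_start k) (iet_of vertex_c ((streak ^^ streaks k) (v (Suc k)))) (hmerge (stage_heights k (loops k))) (quad 0 \<kappa> \<kappa> \<kappa>) \<and>
     winner (rv_iter T (time k)) = 4 \<and> winner (rv_iter T (streak_start k - 1)) = 4" for k
  proof -
    obtain \<kappa> where *: "at_stage T (time k) (iet_of vertex_c (block (loops k) (streaks k) (v (Suc k)))) (heights k) (quad 0 \<kappa> \<kappa> \<kappa>)"
      by (rule block_stage)
    show ?thesis using at_stage_block(2,4,5)[OF * pos] unfolding streak_start_def stage_heights_def by blast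
  qed
  obtain \<kappa> where at: "at_stage T (streak_start k) (iet_of vertex_c ((streak ^^ streaks k) (v (Suc k)))) (hmerge (stage_heights k (loops k))) (quad 0 \<kappa> \<kappa> \<kappa>)"
    and w1: "winner (rv_iter T (streak_start k - 1)) = 4" using facts[of k] by blast
  have w4: "winner (rv_iter T (time k)) = 4" for k using facts[of k] by blast
  have w1': "winner (rv_iter T (streak_start k)) = 1" for k
    using facts[of k] streak_start[of k _ 0] streaks_ge_1[of k] by auto
  have ge: "k \<le> time k" for k by (induction k) auto
  \<comment> \<open>Beyond any \<open>n\<close> there is both a win of D and a win of A, and one of
    them differs from the winner at \<open>n\<close>.\<close>
  have ch: "\<exists>m>n. winner (rv_iter T m) \<noteq> winner (rv_iter T n)" for n
  proof -
    have "n < time (Suc n)" "n < streak_start (Suc n)" using ge[of "Suc n"] by (auto simp: streak_start_def simp del: time.simps)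
    then show ?thesis using w4[of "Suc n"] w1'[of "Suc n"] by (cases "winner (rv_iter T n) = 4") (auto simp del: time.simps)
  qed
  have "0 < streak_start k" by (simp add: streak_start_def)
  then obtain q where q: "1 \<le> q" "zorich_time T q = streak_start k"
    using zorich_time_exists[OF ch, of "streak_start k"] w1 w1'[of k] by auto
  have tS: "streak_start k + 3 * streaks k = time (Suc k)" by (simp add: streak_start_def)
  have "zorich_time T (Suc q) = streak_start k + 3 * streaks k"
  proof (rule zorich_time_Suc[where \<alpha> = 1])
    show "zorich_time T q < streak_start k + 3 * streaks k" using q streaks_ge_1[of k] by simp
    show "winner (rv_iter T j) = 1" if "zorich_time T q \<le> j" "j < streak_start k + 3 * streaks k" for j
      using streak_start[OF at, of "j - streak_start k"] that q by simp
    show "winner (rv_iter T (streak_start k + 3 * streaks k)) \<noteq> 1" using w4[of "Suc k"] unfolding tS by simp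
  qed
  then have Z1: "zorich_matrix T q (q + 1) = rv_matrix T (streak_start k) (streak_start k + 3 * streaks k)"
    and Z0: "zorich_matrix T 0 q = rv_matrix T 0 (streak_start k)"
    using q by (simp_all add: zorich_matrix_def del: zorich_time.simps(2))
  have "real (streaks k) \<le> entry_norm (zorich_matrix T q (q + 1))"
    using streaks_matrix[OF at pos, of "streaks k"] entry_le_entry_norm[of "zorich_matrix T q (q + 1)" 4 1] unfolding Z1 by simp
  moreover have "entry_norm (zorich_matrix T 0 q) \<le> 13 * 2 ^ (10 * stretch k)"
  proof -
    define g where "g = stage_heights k (loops k)"
    have bal: "balanced g" "2 ^ loops k * heights k 2 \<le> g 2" "g 1 \<le> 4 * heights k 2" "g 2 \<le> 2 ^ (10 * stretch k)"
      unfolding g_def by (rule stage_heights_bounds stage_heights_1_le stage_heights_le order_refl)+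
    have "1 * heights k 2 \<le> 2 ^ loops k * heights k 2" by (rule mult_right_mono) auto
    then have "g 1 \<le> 4 * g 2" using bal by linarith
    \<comment> \<open>The sum is \<open>g 1 + g 2 + g 3 + 3 * g 4\<close>, which is at most 4 + 1 +
      2 + 6 = 13 times \<open>g 2\<close>.\<close>
    then have "hmerge g 1 + hmerge g 2 + hmerge g 3 + hmerge g 4 \<le> 13 * g 2" using bal(1) unfolding balanced_def by simp
    then have "hmerge g 1 + hmerge g 2 + hmerge g 3 + hmerge g 4 \<le> 13 * 2 ^ (10 * stretch k)" using bal(4) by linarith
    then have "real (hmerge g 1 + hmerge g 2 + hmerge g 3 + hmerge g 4) \<le> real (13 * 2 ^ (10 * stretch k))" by (rule of_nat_mono)
    then show ?thesis unfolding Z0 entry_norm_at_stage[OF at] sum_4 g_def by simp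
  qed
  ultimately show ?thesis using q(1) unfolding streaks_def by (intro exI[of _ q]) simp
qed

text \<open>With \<epsilon> = 1/20 the right-hand side is at most 13 \<open>C\<close> 2^(l/2), half
  the exponent of the lower bound 2^l for the Zorich step, and l = \<open>stretch k\<close> is
  unbounded.\<close>

lemma T_not_condition_Z: "\<not> condition_Z T"
proof
  assume "condition_Z T"
  then obtain C where C: "0 < C" "\<And>k. 1 \<le> k \<Longrightarrow> entry_norm (zorich_matrix T k (k + 1)) \<le> C * entry_norm (zorich_matrix T 0 k) powr (1 / 20)"
    unfolding condition_Z_def by (metis zero_less_divide_1_iff zero_less_numeral)
  have le: "(2::real) ^ l \<le> (13 * C) ^ 2" if l: "l = stretch k" for k l
  proof -
    obtain q where q: "1 \<le> q" "entry_norm (zorich_matrix T 0 q) \<le> 13 * 2 ^ (10 * l)" "2 ^ l \<le> entry_norm (zorich_matrix T q (q + 1))"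
      using zorich_streak[of k] unfolding l by blast
    have "0 \<le> entry_norm (zorich_matrix T 0 q)" unfolding entry_norm_def by (intro sum_nonneg) auto
    then have "entry_norm (zorich_matrix T 0 q) powr (1 / 20) \<le> (13 * 2 ^ (10 * l)) powr (1 / 20)"
      using q(2) by (intro powr_mono2) auto
    also have "\<dots> = 13 powr (1 / 20) * 2 powr (real l / 2)"
      by (simp add: powr_mult powr_realpow[symmetric] powr_powr)
    also have "\<dots> \<le> 13 powr 1 * 2 powr (real l / 2)" by (intro mult_right_mono powr_mono) auto
    finally have "C * entry_norm (zorich_matrix T 0 q) powr (1 / 20) \<le> C * (13 * 2 powr (real l / 2))"
      using C(1) by (intro mult_left_mono) auto
    with C(2)[OF q(1)] q(3) have "2 ^ l \<le> 13 * C * 2 powr (real l / 2)" by (simp add: mult_ac)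
    moreover have "(2::real) ^ l = 2 powr (real l / 2) * 2 powr (real l / 2)" by (simp add: powr_add[symmetric] powr_realpow[symmetric])
    ultimately have "2 powr (real l / 2) \<le> 13 * C" by simp
    then have "(2 powr (real l / 2)) ^ 2 \<le> (13 * C) ^ 2" by (intro power_mono) auto
    then show ?thesis by (simp add: power2_eq_square powr_add[symmetric] powr_realpow[symmetric])
  qed
  obtain k where "(13 * C) ^ 2 < 2 ^ k" using real_arch_pow[of 2 "(13 * C) ^ 2"] by auto
  also have "(2::real) ^ k \<le> 2 ^ stretch k" by (intro power_increasing) (auto simp: stretch_def less_imp_le)
  finally show False using le[OF refl, of k] by simp
qed

end

theorem mainTheorem6:
  shows "\<exists>T :: 4 iet.
    is_iet T \<and> admissible T \<and> keane T \<and> total_len T = 1 \<and>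
    condition_R T \<and> \<not> condition_Z T"
proof -
  obtain v :: "nat \<Rightarrow> real^4" where "\<And>k. v k = block (loops k) (streaks k) (v (Suc k))" "\<And>k i. 0 \<le> v k $ i"
    "(\<Sum>i\<in>UNIV. v 0 $ i) = 1"
    using cone_map_sequence[of "\<lambda>k. block (loops k) (streaks k)", OF cone_maps(4)] by blast
  then interpret nested_blocks v by unfold_locales
  have "condition_R T" by (rule condition_R_if_thin_towers[OF T_iet T_total T_thin_towers]) auto
  then show ?thesis using T_iet T_admissible T_keane T_total T_not_condition_Z by blast
qed

end
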